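(* Let $n\ge 6$. Among all connected cubic bipartite graphs on $2n$ vertices, $H_{2n}$ is the unique graph (up to isomorphism) with the minimum spectral gap.
   Context: All graphs are finite, simple and undirected. A graph is cubic if every vertex has degree $3$. The spectral gap of a graph $G$ is the difference between the two largest eigenvalues (counted with multiplicity) of its adjacency matrix. For $n\ge 6$, $H_{2n}$ is the cubic bipartite graph with parts $\{u_1,\dots,u_n\}$ and $\{v_1,\dots,v_n\}$ and exactly the following edges: (i) $u_iv_j$ for all $i,j\in\{1,2,3\}$ except $(i,j)=(3,3)$; (ii) $u_iv_{i+1}$ and $v_iu_{i+1}$ for $3\le i\le n-3$; (iii) $u_iv_i$ for $4\le i\le n-3$; (iv) $u_iv_j$ for all $i,j\in\{n-2,n-1,n\}$ except $(i,j)=(n-2,n-2)$. *)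

theory Defs
  imports
    "Graph_Theory.Graph_Theory"
    "Jordan_Normal_Form.Char_Poly"
    "HOL-Library.Multiset"
begin

text \<open>
  A finite simple undirected graph is a \<open>pair_graph\<close>: a finite vertex set with a symmetric,
  loop-free set of arcs, each edge being represented by its two orientations. Hence the
  out-degree of a vertex is its degree.
\<close>

definition cubic :: "'a pair_pre_digraph \<Rightarrow> bool" where
  "cubic G \<longleftrightarrow> (\<forall>v \<in> pverts G. out_degree (with_proj G) v = 3)"

definition bipartite :: "'a pair_pre_digraph \<Rightarrow> bool" where
  "bipartite G \<longleftrightarrow> (\<exists>X Y. X \<union> Y = pverts G \<and> X \<inter> Y = {} \<and>
     (\<forall>(a, b) \<in> parcs G. (a \<in> X \<and> b \<in> Y) \<or> (a \<in> Y \<and> b \<in> X)))"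

definition connected_cubic_bipartite_graphs :: "nat \<Rightarrow> 'a pair_pre_digraph set" where
  "connected_cubic_bipartite_graphs m =
     {G. pair_graph G \<and> Digraph_Component.connected (with_proj G) \<and> cubic G \<and> bipartite G \<and>
         card (pverts G) = m}"

definition adjacency_matrix :: "'a pair_pre_digraph \<Rightarrow> 'a list \<Rightarrow> real mat" where
  "adjacency_matrix G vs =
     mat (length vs) (length vs) (\<lambda>(i, j). if (vs ! i, vs ! j) \<in> parcs G then 1 else 0)"

text \<open>
  The eigenvalues in descending order, repeated according to algebraic multiplicity. The
  enumeration of the vertices is arbitrary; \<open>graph_eigenvalues_eq\<close> below shows that it does
  not matter.
\<close>

definition graph_eigenvalues :: "'a pair_pre_digraph \<Rightarrow> real list" where
  "graph_eigenvalues G =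
     rev (sorted_list_of_multiset (proots (char_poly
       (adjacency_matrix G (SOME vs. distinct vs \<and> set vs = pverts G)))))"

definition spectral_gap :: "'a pair_pre_digraph \<Rightarrow> real" where
  "spectral_gap G = graph_eigenvalues G ! 0 - graph_eigenvalues G ! 1"

lemma similar_adjacency_matrix:
  fixes G :: "'a pair_pre_digraph"
  assumes vs: "distinct vs" and ws: "distinct ws" and eq: "set vs = set ws"
  shows "similar_mat (adjacency_matrix G vs) (adjacency_matrix G ws)"
proof -
  define n where "n = length vs"
  have n': "length ws = n"
    unfolding n_def using vs ws eq by (metis distinct_card)
  define P :: "'a list \<Rightarrow> 'a list \<Rightarrow> real mat"
    where "P xs ys = mat n n (\<lambda>(i, j). if xs ! i = ys ! j then 1 else 0)" for xs ys
  have pick: "\<exists>k<n. xs ! i = ys ! k \<and> (\<forall>k'<n. xs ! i = ys ! k' \<longleftrightarrow> k' = k)"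
    if "distinct ys" "set xs = set ys" "length xs = n" "length ys = n" "i < n"
    for xs ys :: "'a list" and i
    using that by (metis in_set_conv_nth nth_eq_iff_index_eq)
  have mult: "(\<Sum>k = 0..<n. (if xs ! i = ys ! k then 1 else 0) * f (ys ! k)) = f (xs ! i)"
    if "distinct ys" "set xs = set ys" "length xs = n" "length ys = n" "i < n"
    for xs ys :: "'a list" and i and f :: "'a \<Rightarrow> real"
  proof -
    note T = that
    obtain k where k: "k < n" "xs ! i = ys ! k" "\<forall>k'<n. xs ! i = ys ! k' \<longleftrightarrow> k' = k"
      using pick[OF T] by blast
    have "(\<Sum>k' = 0..<n. (if xs ! i = ys ! k' then 1 else 0) * f (ys ! k')) =
          (\<Sum>k' = 0..<n. if k' = k then f (ys ! k') else 0)"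
      by (rule sum.cong) (use k in auto)
    also have "\<dots> = f (ys ! k)" using k(1) by simp
    finally show ?thesis by (simp only: k(2))
  qed
  have mult': "(\<Sum>k = 0..<n. f (ys ! k) * (if ys ! k = xs ! i then 1 else 0)) = f (xs ! i)"
    if "distinct ys" "set xs = set ys" "length xs = n" "length ys = n" "i < n"
    for xs ys :: "'a list" and i and f :: "'a \<Rightarrow> real"
    unfolding mult[OF that, of f, symmetric] by (rule sum.cong) auto
  have inv: "P xs ys * P ys xs = 1\<^sub>m n"
    if "distinct ys" "distinct xs" "set xs = set ys" "length xs = n" "length ys = n"
    for xs ys :: "'a list"
  proof (rule eq_matI, goal_cases)
    case (1 i j)
    then have ij: "i < n" "j < n" by auto
    have "(P xs ys * P ys xs) $$ (i, j) =
      (\<Sum>k = 0..<n. (if xs ! i = ys ! k then 1 else 0) * (if ys ! k = xs ! j then 1 else 0))"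
      using ij by (simp add: P_def scalar_prod_def)
    also have "\<dots> = (if xs ! i = xs ! j then 1 else 0)"
      by (rule mult[where f = "\<lambda>x. if x = xs ! j then 1 else 0"]) (use that ij in auto)
    finally show ?case using ij that by (simp add: nth_eq_iff_index_eq)
  qed (auto simp: P_def)
  have conj: "adjacency_matrix G vs = P vs ws * adjacency_matrix G ws * P ws vs"
  proof (rule eq_matI, goal_cases)
    case (1 i j)
    then have ij: "i < n" "j < n" by (auto simp: P_def)
    define a :: "'a \<Rightarrow> 'a \<Rightarrow> real" where "a x y = (if (x, y) \<in> parcs G then 1 else 0)" for x y
    have row: "(P vs ws * adjacency_matrix G ws) $$ (i, l) = a (vs ! i) (ws ! l)"
      if "l < n" for l
    proof -
      have "(P vs ws * adjacency_matrix G ws) $$ (i, l) =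
        (\<Sum>k = 0..<n. (if vs ! i = ws ! k then 1 else 0) * a (ws ! k) (ws ! l))"
        using that ij n' by (simp add: P_def adjacency_matrix_def scalar_prod_def a_def)
      also have "\<dots> = a (vs ! i) (ws ! l)"
        by (rule mult[where f = "\<lambda>x. a x (ws ! l)"]) (use ws eq n' ij n_def in auto)
      finally show ?thesis .
    qed
    have "(P vs ws * adjacency_matrix G ws * P ws vs) $$ (i, j) =
      (\<Sum>l = 0..<n. (P vs ws * adjacency_matrix G ws) $$ (i, l) * P ws vs $$ (l, j))"
      using ij n' by (simp add: P_def adjacency_matrix_def scalar_prod_def)
    also have "\<dots> = (\<Sum>l = 0..<n. a (vs ! i) (ws ! l) * (if ws ! l = vs ! j then 1 else 0))"
      by (rule sum.cong) (use row ij in \<open>auto simp: P_def\<close>)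
    also have "\<dots> = a (vs ! i) (vs ! j)"
      by (rule mult') (use ws eq n' ij n_def in auto)
    finally show ?case using ij by (simp add: adjacency_matrix_def a_def n_def)
  qed (auto simp: P_def adjacency_matrix_def n_def)
  have "similar_mat_wit (adjacency_matrix G vs) (adjacency_matrix G ws) (P vs ws) (P ws vs)"
    by (rule similar_mat_witI[where n = n])
       (use inv conj vs ws eq n' n_def in \<open>auto simp: P_def adjacency_matrix_def\<close>)
  then show ?thesis unfolding similar_mat_def by blast
qed

lemma graph_eigenvalues_eq:
  assumes "distinct vs" and "set vs = pverts G"
  shows "graph_eigenvalues G = rev (sorted_list_of_multiset (proots (char_poly (adjacency_matrix G vs))))"
proof -
  let ?ws = "SOME vs. distinct vs \<and> set vs = pverts G"
  have "distinct ?ws \<and> set ?ws = pverts G"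
    by (rule someI[of _ vs]) (use assms in auto)
  then have "similar_mat (adjacency_matrix G ?ws) (adjacency_matrix G vs)"
    using assms by (intro similar_adjacency_matrix) auto
  then show ?thesis unfolding graph_eigenvalues_def by (simp add: char_poly_similar)
qed

text \<open>
  The graph $H_{2n}$ for \<open>n \<ge> 6\<close>, with $u_i$ encoded as \<open>Inl i\<close> and $v_i$ as \<open>Inr i\<close>. Every
  edge is listed in one orientation; \<open>H_graph\<close> adds the reverse arcs. For \<open>n \<ge> 6\<close> no
  subtraction truncates.
\<close>

definition H_edges :: "nat \<Rightarrow> (nat + nat) rel" where
  "H_edges n =
     {(Inl i, Inr j) | i j. i \<in> {1, 2, 3} \<and> j \<in> {1, 2, 3} \<and> (i, j) \<noteq> (3, 3)} \<union>
     {(Inl i, Inr (i + 1)) | i. 3 \<le> i \<and> i \<le> n - 3} \<union>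
     {(Inr i, Inl (i + 1)) | i. 3 \<le> i \<and> i \<le> n - 3} \<union>
     {(Inl i, Inr i) | i. 4 \<le> i \<and> i \<le> n - 3} \<union>
     {(Inl i, Inr j) | i j. i \<in> {n - 2, n - 1, n} \<and> j \<in> {n - 2, n - 1, n} \<and>
        (i, j) \<noteq> (n - 2, n - 2)}"

definition H_graph :: "nat \<Rightarrow> (nat + nat) pair_pre_digraph" where
  "H_graph n = \<lparr>pverts = Inl ` {1..n} \<union> Inr ` {1..n}, parcs = H_edges n \<union> (H_edges n)\<inverse>\<rparr>"

end

theory Submission
  imports Defs "HOL-Analysis.Function_Topology"
begin

text \<open>
  A connected cubic graph has the simple largest eigenvalue \<open>3\<close>, with constant eigenvectors, so its
  spectral gap is \<open>3 - \<lambda>\<close>, where \<open>\<lambda>\<close> is the maximum of the Rayleigh quotient of the adjacency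
  matrix on the vectors with zero sum. The claim is that the graph $H_{2n}$, and no other graph, makes
  \<open>\<lambda>\<close> as large as possible.

  Let \<open>x\<close> be an eigenvector of \<open>G\<close> for \<open>\<lambda>\<close>. Number the two colour classes so that \<open>x\<close> takes the
  nondecreasing values \<open>a\<^sub>1, \<dots>, a\<^sub>n\<close> and \<open>b\<^sub>1, \<dots>, b\<^sub>n\<close>, and let \<open>E\<close> be the set of all \<open>(i, j)\<close>
  such that the \<open>i\<close>-th and the \<open>j\<close>-th vertex are adjacent. The quadratic form of \<open>G\<close> at \<open>x\<close> is twice
  the sum of \<open>a\<^sub>i b\<^sub>j\<close> over \<open>E\<close>. Abel summation in both indices turns this sum into a constant plus
  the sum of \<open>(a\<^sub>k\<^sub>+\<^sub>1 - a\<^sub>k) (b\<^sub>l\<^sub>+\<^sub>1 - b\<^sub>l)\<close> times the number of elements of \<open>E\<close> in the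
  corner \<open>{1..k} \<times> {1..l}\<close> (\<open>bilinear_eq_corners\<close>). All these weights are nonnegative, so it is
  enough to compare corner counts. Row and column sums \<open>3\<close> bound every corner count from above, and
  connectivity forbids the value \<open>3 k\<close> on the diagonal. The biadjacency pattern of $H_{2n}$, called
  \<open>ladder n\<close> below, attains the least of these bounds at every corner (\<open>corner_le_ladder\<close>). Transplanting the values of
  \<open>x\<close> to $H_{2n}$ therefore does not decrease the Rayleigh quotient.

  If the two gaps agree, then the transplanted vector is an eigenvector of $H_{2n}$. Its values on the
  two classes coincide, because the ladder pattern has no eigenvalue below \<open>-2\<close> while \<open>\<lambda> > 2\<close>, and
  they increase strictly from position \<open>2\<close> to position \<open>n - 1\<close>
  (\<open>ladder_eigenvector_strict_mono\<close>). So \<open>E\<close> and the ladder have the same corner counts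
  for \<open>2 \<le> k, l \<le> n - 2\<close>, and these determine a cubic pattern (\<open>eq_ladder_if_corners_eq\<close>).
\<close>

section \<open>Rayleigh quotients on a finite set\<close>

definition quad_form :: "'v set \<Rightarrow> ('v \<Rightarrow> 'v \<Rightarrow> real) \<Rightarrow> ('v \<Rightarrow> real) \<Rightarrow> real" where
  "quad_form V f y = (\<Sum>v\<in>V. \<Sum>w\<in>V. f v w * y v * y w)"

lemma nonpos_if_linear_le_quadratic:
  fixes b c :: real
  assumes "\<And>e. e > 0 \<Longrightarrow> 2 * e * b + e\<^sup>2 * c \<le> 0"
  shows "b \<le> 0"
proof (rule ccontr)
  assume "\<not> b \<le> 0"
  then have b: "b > 0" by simp
  \<comment> \<open>small enough for the linear term to dominate\<close>
  define e where "e = b / (1 + \<bar>c\<bar>)"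
  have e: "e > 0" using b by (simp add: e_def)
  have "e * (2 * b + e * c) \<le> 0"
    using assms[OF e] by (simp add: power2_eq_square algebra_simps)
  then have "2 * b + e * c \<le> 0" using e by (simp add: mult_le_0_iff)
  moreover have "e * \<bar>c\<bar> \<le> b" unfolding e_def using b by (simp add: field_simps)
  moreover have "- (e * \<bar>c\<bar>) \<le> e * c" using e by (metis abs_ge_minus_self abs_mult abs_of_pos minus_le_iff)
  ultimately show False using b by linarith
qed

lemma quad_form_add_scaled:
  assumes "\<And>v w. v \<in> V \<Longrightarrow> w \<in> V \<Longrightarrow> f v w = f w v"
  shows "quad_form V f (\<lambda>v. x v + e * g v) =
    quad_form V f x + 2 * e * (\<Sum>v\<in>V. g v * (\<Sum>w\<in>V. f v w * x w)) + e\<^sup>2 * quad_form V f g"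
proof -
  have "(\<Sum>v\<in>V. \<Sum>w\<in>V. f v w * x v * g w) = (\<Sum>w\<in>V. \<Sum>v\<in>V. f v w * x v * g w)"
    by (rule sum.swap)
  also have "\<dots> = (\<Sum>v\<in>V. \<Sum>w\<in>V. f v w * g v * x w)"
    by (intro sum.cong refl) (use assms in auto)
  finally have swap: "(\<Sum>v\<in>V. \<Sum>w\<in>V. f v w * x v * g w) = (\<Sum>v\<in>V. \<Sum>w\<in>V. f v w * g v * x w)" .
  have "quad_form V f (\<lambda>v. x v + e * g v) =
    (\<Sum>v\<in>V. \<Sum>w\<in>V. f v w * x v * x w + e * (f v w * x v * g w) + e * (f v w * g v * x w)
       + e\<^sup>2 * (f v w * g v * g w))"
    unfolding quad_form_def by (intro sum.cong refl) (simp add: algebra_simps power2_eq_square)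
  also have "\<dots> = quad_form V f x + e * (\<Sum>v\<in>V. \<Sum>w\<in>V. f v w * x v * g w)
      + e * (\<Sum>v\<in>V. \<Sum>w\<in>V. f v w * g v * x w) + e\<^sup>2 * quad_form V f g"
    unfolding quad_form_def by (simp add: sum.distrib sum_distrib_left)
  also have "(\<Sum>v\<in>V. \<Sum>w\<in>V. f v w * g v * x w) = (\<Sum>v\<in>V. g v * (\<Sum>w\<in>V. f v w * x w))"
    by (simp add: sum_distrib_left mult_ac)
  finally show ?thesis unfolding swap by (simp add: sum_distrib_left mult_ac)
qed

lemma sum_kernel_image:
  fixes f :: "'v \<Rightarrow> 'v \<Rightarrow> real"
  assumes sym: "\<And>v w. v \<in> V \<Longrightarrow> w \<in> V \<Longrightarrow> f v w = f w v"
    and row: "\<And>v. v \<in> V \<Longrightarrow> (\<Sum>w\<in>V. f v w) = r"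
  shows "(\<Sum>v\<in>V. \<Sum>w\<in>V. f v w * x w) = r * (\<Sum>v\<in>V. x v)"
proof -
  have "(\<Sum>v\<in>V. \<Sum>w\<in>V. f v w * x w) = (\<Sum>w\<in>V. \<Sum>v\<in>V. f v w * x w)" by (rule sum.swap)
  also have "\<dots> = (\<Sum>w\<in>V. (\<Sum>v\<in>V. f w v) * x w)"
    unfolding sum_distrib_right by (intro sum.cong refl) (use sym in auto)
  also have "\<dots> = r * (\<Sum>v\<in>V. x v)" by (simp add: row sum_distrib_left)
  finally show ?thesis .
qed

lemma quad_form_eigenvector:
  assumes "\<And>v. v \<in> V \<Longrightarrow> (\<Sum>w\<in>V. f v w * x w) = l * x v"
  shows "quad_form V f x = l * (\<Sum>v\<in>V. (x v)\<^sup>2)"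
proof -
  have "quad_form V f x = (\<Sum>v\<in>V. x v * (\<Sum>w\<in>V. f v w * x w))"
    unfolding quad_form_def by (simp add: sum_distrib_left mult_ac)
  also have "\<dots> = (\<Sum>v\<in>V. l * (x v)\<^sup>2)"
    by (intro sum.cong refl) (simp add: assms power2_eq_square)
  finally show ?thesis by (simp add: sum_distrib_left)
qed

text \<open>
  First variation: the residual \<open>g = f x - l x\<close> again has zero sum, so \<open>x\<close> may be perturbed by
  \<open>e g\<close>. The first-order change of the form minus \<open>l\<close> times the squared norm is \<open>2 e\<close> times the
  squared norm of \<open>g\<close>, which maximality forces to vanish.
\<close>

lemma maximiser_is_eigenvector:
  fixes f :: "'v \<Rightarrow> 'v \<Rightarrow> real"
  assumes fin: "finite V"
    and sym: "\<And>v w. v \<in> V \<Longrightarrow> w \<in> V \<Longrightarrow> f v w = f w v"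
    and row: "\<And>v. v \<in> V \<Longrightarrow> (\<Sum>w\<in>V. f v w) = r"
    and bound: "\<And>y. (\<Sum>v\<in>V. y v) = 0 \<Longrightarrow> quad_form V f y \<le> l * (\<Sum>v\<in>V. (y v)\<^sup>2)"
    and x0: "(\<Sum>v\<in>V. x v) = 0"
    and attained: "quad_form V f x = l * (\<Sum>v\<in>V. (x v)\<^sup>2)"
    and v: "v \<in> V"
  shows "(\<Sum>w\<in>V. f v w * x w) = l * x v"
proof -
  define g where "g v = (\<Sum>w\<in>V. f v w * x w) - l * x v" for v
  have g0: "(\<Sum>v\<in>V. g v) = 0"
    unfolding g_def sum_subtractf using sum_kernel_image[of V f r x] sym row x0
    by (simp add: sum_distrib_left [symmetric])
  have "2 * e * (\<Sum>v\<in>V. (g v)\<^sup>2) + e\<^sup>2 * (quad_form V f g - l * (\<Sum>v\<in>V. (g v)\<^sup>2)) \<le> 0" for e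
  proof -
    have "(\<Sum>v\<in>V. x v + e * g v) = 0"
      using x0 g0 by (simp add: sum.distrib sum_distrib_left [symmetric])
    then have "quad_form V f (\<lambda>v. x v + e * g v) \<le> l * (\<Sum>v\<in>V. (x v + e * g v)\<^sup>2)"
      by (rule bound)
    also have "(\<Sum>v\<in>V. (x v + e * g v)\<^sup>2) =
        (\<Sum>v\<in>V. (x v)\<^sup>2) + 2 * e * (\<Sum>v\<in>V. g v * x v) + e\<^sup>2 * (\<Sum>v\<in>V. (g v)\<^sup>2)"
      by (simp add: power2_sum sum.distrib sum_distrib_left mult_ac power_mult_distrib)
    also have "quad_form V f (\<lambda>v. x v + e * g v) =
        l * (\<Sum>v\<in>V. (x v)\<^sup>2) + 2 * e * ((\<Sum>v\<in>V. (g v)\<^sup>2) + l * (\<Sum>v\<in>V. g v * x v)) + e\<^sup>2 * quad_form V f g"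
    proof -
      have "(\<Sum>v\<in>V. g v * (\<Sum>w\<in>V. f v w * x w)) = (\<Sum>v\<in>V. (g v)\<^sup>2 + l * (g v * x v))"
        by (intro sum.cong refl) (simp add: g_def power2_eq_square algebra_simps)
      then have "(\<Sum>v\<in>V. g v * (\<Sum>w\<in>V. f v w * x w)) = (\<Sum>v\<in>V. (g v)\<^sup>2) + l * (\<Sum>v\<in>V. g v * x v)"
        by (simp add: sum.distrib sum_distrib_left)
      then show ?thesis using quad_form_add_scaled[of V f x e g] sym attained by simp
    qed
    finally show ?thesis by (simp add: algebra_simps)
  qed
  then have "(\<Sum>v\<in>V. (g v)\<^sup>2) \<le> 0" by (rule nonpos_if_linear_le_quadratic)
  then have "(g v)\<^sup>2 = 0"
    using v fin by (metis (no_types, lifting) order_antisym sum_nonneg sum_nonneg_eq_0_iff zero_le_power2)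
  then show ?thesis by (simp add: g_def)
qed

text \<open>
  The unit sphere of the vectors with zero sum is compact. The vectors are functions on an
  arbitrary type, so compactness is taken in the product topology; on the coordinates outside \<open>V\<close>
  the functions are required to be \<open>0\<close>.
\<close>

lemma ex_maximiser:
  fixes f :: "'v \<Rightarrow> 'v \<Rightarrow> real"
  assumes fin: "finite V" and two: "a \<in> V" "b \<in> V" "a \<noteq> b"
  obtains l x where "(\<Sum>v\<in>V. x v) = 0" "\<exists>v\<in>V. x v \<noteq> 0"
    "quad_form V f x = l * (\<Sum>v\<in>V. (x v)\<^sup>2)"
    "\<And>y. (\<Sum>v\<in>V. y v) = 0 \<Longrightarrow> quad_form V f y \<le> l * (\<Sum>v\<in>V. (y v)\<^sup>2)"
proof -
  define B :: "'v \<Rightarrow> real set" where "B v = (if v \<in> V then {-1..1} else {0})" for v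
  define S where "S = PiE UNIV B \<inter> {x. (\<Sum>v\<in>V. x v) = 0} \<inter> {x. (\<Sum>v\<in>V. (x v)\<^sup>2) = 1}"
  have coord: "continuous_on UNIV (\<lambda>x :: 'v \<Rightarrow> real. x v)" for v by simp
  have "compactin (product_topology (\<lambda>v::'v. euclidean :: real topology) UNIV) (PiE UNIV B)"
    unfolding compactin_PiE by (auto simp: B_def)
  then have "compact (PiE UNIV B)"
    by (simp add: euclidean_product_topology)
  moreover have "closed {x :: 'v \<Rightarrow> real. (\<Sum>v\<in>V. x v) = 0}"
    by (intro closed_Collect_eq continuous_intros coord)
  moreover have "closed {x :: 'v \<Rightarrow> real. (\<Sum>v\<in>V. (x v)\<^sup>2) = 1}"
    by (intro closed_Collect_eq continuous_intros coord)
  ultimately have comp: "compact S" unfolding S_def by (intro compact_Int_closed)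
  have in_S: "(\<lambda>v. if v \<in> V then y v / sqrt (\<Sum>v\<in>V. (y v)\<^sup>2) else 0) \<in> S" (is "?z \<in> S")
    if y: "(\<Sum>v\<in>V. y v) = 0" "(\<Sum>v\<in>V. (y v)\<^sup>2) > 0" for y
  proof -
    let ?s = "\<Sum>v\<in>V. (y v)\<^sup>2"
    have sum1: "(\<Sum>v\<in>V. (?z v)\<^sup>2) = 1"
      using y by (simp add: power_divide sum_divide_distrib [symmetric])
    have "(?z v)\<^sup>2 \<le> 1" if "v \<in> V" for v
      using member_le_sum[of v V "\<lambda>v. (?z v)\<^sup>2"] fin that unfolding sum1 by simp
    then have "\<bar>?z v\<bar> \<le> 1" if "v \<in> V" for v using that abs_square_le_1 by blast
    then have "?z v \<in> B v" for v
      by (cases "v \<in> V") (fastforce simp: B_def abs_le_iff simp del: abs_divide)+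
    moreover have "(\<Sum>v\<in>V. ?z v) = 0"
      using y by (simp add: sum_divide_distrib [symmetric])
    ultimately show ?thesis using sum1 unfolding S_def by (auto simp: PiE_def)
  qed
  define y0 :: "'v \<Rightarrow> real" where "y0 v = (if v = a then 1 else if v = b then -1 else 0)" for v
  have y0: "(\<Sum>v\<in>V. h (y0 v)) = h 1 + h (-1)" if "h 0 = 0" for h :: "real \<Rightarrow> real"
  proof -
    have "(\<Sum>v\<in>V. h (y0 v)) = (\<Sum>v\<in>{a, b}. h (y0 v))"
      by (rule sum.mono_neutral_right) (use fin two that in \<open>auto simp: y0_def\<close>)
    then show ?thesis using two by (simp add: y0_def)
  qed
  have "S \<noteq> {}" using in_S[of y0] y0[of "\<lambda>t. t"] y0[of "\<lambda>t. t\<^sup>2"] by auto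
  moreover have "continuous_on S (quad_form V f)"
    unfolding quad_form_def
    by (intro continuous_intros continuous_on_subset[OF coord]) auto
  ultimately obtain x where x: "x \<in> S" and max: "\<And>y. y \<in> S \<Longrightarrow> quad_form V f y \<le> quad_form V f x"
    using continuous_attains_sup[OF comp] by blast
  have x': "(\<Sum>v\<in>V. x v) = 0" "(\<Sum>v\<in>V. (x v)\<^sup>2) = 1" using x by (auto simp: S_def)
  show thesis
  proof (rule that[of x "quad_form V f x"])
    show "\<exists>v\<in>V. x v \<noteq> 0" using x'(2) by (auto intro: ccontr)
  next
    fix y :: "'v \<Rightarrow> real" assume y: "(\<Sum>v\<in>V. y v) = 0"
    let ?s = "\<Sum>v\<in>V. (y v)\<^sup>2"
    show "quad_form V f y \<le> quad_form V f x * ?s"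
    proof (cases "?s > 0")
      case True
      have "quad_form V f (\<lambda>v. if v \<in> V then y v / sqrt ?s else 0) = quad_form V f y / ?s"
      proof -
        have "quad_form V f (\<lambda>v. if v \<in> V then y v / sqrt ?s else 0) =
          (\<Sum>v\<in>V. \<Sum>w\<in>V. f v w * y v * y w / ?s)"
          unfolding quad_form_def
          by (intro sum.cong refl) (use True in \<open>simp add: real_sqrt_mult_self\<close>)
        then show ?thesis unfolding quad_form_def by (simp add: sum_divide_distrib)
      qed
      then have "quad_form V f y / ?s \<le> quad_form V f x"
        using max[OF in_S[OF y True]] by simp
      then show ?thesis using True by (simp add: field_simps)
    next
      case False
      then have "?s = 0" by (meson not_le order_antisym_conv sum_nonneg zero_le_power2 linorder_not_less)
      then have "\<forall>v\<in>V. y v = 0" using fin by (simp add: sum_nonneg_eq_0_iff)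
      then show ?thesis unfolding quad_form_def by simp
    qed
  qed (use x' in auto)
qed

lemma sum_kernel_sq_diff:
  fixes f :: "'v \<Rightarrow> 'v \<Rightarrow> real"
  assumes sym: "\<And>v w. v \<in> V \<Longrightarrow> w \<in> V \<Longrightarrow> f v w = f w v"
    and row: "\<And>v. v \<in> V \<Longrightarrow> (\<Sum>w\<in>V. f v w) = r"
  shows "(\<Sum>v\<in>V. \<Sum>w\<in>V. f v w * (z v - z w)\<^sup>2) = 2 * (r * (\<Sum>v\<in>V. (z v)\<^sup>2) - quad_form V f z)"
proof -
  have "(\<Sum>v\<in>V. \<Sum>w\<in>V. f v w * (z v - z w)\<^sup>2) =
    (\<Sum>v\<in>V. (\<Sum>w\<in>V. f v w) * (z v)\<^sup>2) + (\<Sum>v\<in>V. \<Sum>w\<in>V. f v w * (z w)\<^sup>2) - 2 * quad_form V f z"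
    unfolding quad_form_def sum_distrib_left sum_distrib_right sum.distrib [symmetric] sum_subtractf [symmetric]
    by (intro sum.cong refl) (simp add: power2_eq_square algebra_simps)
  also have "(\<Sum>v\<in>V. (\<Sum>w\<in>V. f v w) * (z v)\<^sup>2) = r * (\<Sum>v\<in>V. (z v)\<^sup>2)"
    by (simp add: row sum_distrib_left)
  also have "(\<Sum>v\<in>V. \<Sum>w\<in>V. f v w * (z w)\<^sup>2) = r * (\<Sum>v\<in>V. (z v)\<^sup>2)"
    by (rule sum_kernel_image) (use sym row in auto)
  finally show ?thesis by simp
qed

section \<open>Splitting off the eigenvalue of the constant vector\<close>

text \<open>
  Conjugation by the identity matrix with its first column replaced by ones turns the constant
  eigenvector into the first unit vector and leaves a block triangular matrix. This separates one
  copy of the root \<open>r\<close>, so that its algebraic multiplicity can be controlled.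
\<close>

lemma char_poly_deflate_constant_row_sum:
  fixes A :: "'a :: field mat"
  assumes A: "A \<in> carrier_mat (Suc m) (Suc m)"
    and row: "\<And>i. i \<le> m \<Longrightarrow> (\<Sum>j<Suc m. A $$ (i, j)) = r"
  shows "char_poly A = [:- r, 1:] * char_poly (mat m m (\<lambda>(i, j). A $$ (Suc i, Suc j) - A $$ (0, Suc j)))"
proof -
  let ?N = "Suc m"
  define P :: "'a mat" where
    "P = mat ?N ?N (\<lambda>(i, j). (if j = 0 then 1 else 0) + (if j = i then if j = 0 then 0 else 1 else 0))"
  define Q :: "'a mat" where
    "Q = mat ?N ?N (\<lambda>(i, j). (if j = i then 1 else 0) - (if j = 0 then if i = 0 then 0 else 1 else 0))"
  define B where "B = mat m m (\<lambda>(i, j). A $$ (Suc i, Suc j) - A $$ (0, Suc j))"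
  define C where "C = four_block_mat (mat 1 1 (\<lambda>_. r)) (mat 1 m (\<lambda>(i, j). A $$ (0, Suc j))) (0\<^sub>m m 1) B"
  have carr: "P \<in> carrier_mat ?N ?N" "Q \<in> carrier_mat ?N ?N" "C \<in> carrier_mat ?N ?N"
    by (auto simp: P_def Q_def C_def B_def)
  have C: "C $$ (i, j) = (if j = 0 then if i = 0 then r else 0
      else A $$ (i, j) - (if i = 0 then 0 else A $$ (0, j)))" if "i < ?N" "j < ?N" for i j
    using that by (auto simp: C_def B_def)
  have PQ: "P * Q = 1\<^sub>m ?N"
  proof (rule eq_matI)
    fix i j assume "i < dim_row (1\<^sub>m ?N :: 'a mat)" "j < dim_col (1\<^sub>m ?N :: 'a mat)"
    then have ij: "i < ?N" "j < ?N" by auto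
    have "(P * Q) $$ (i, j) = (\<Sum>k = 0..<?N. P $$ (i, k) * Q $$ (k, j))"
      using ij carr by (simp add: scalar_prod_def)
    also have "\<dots> = (\<Sum>k = 0..<?N. (if k = 0 then Q $$ (k, j) else 0) +
        (if k = i then if k = 0 then 0 else Q $$ (k, j) else 0))"
      by (intro sum.cong refl) (use ij in \<open>auto simp: P_def\<close>)
    also have "\<dots> = Q $$ (0, j) + (if i = 0 then 0 else Q $$ (i, j))"
      using ij by (simp add: sum.distrib del: sum.op_ivl_Suc)
    also have "\<dots> = 1\<^sub>m ?N $$ (i, j)" using ij by (auto simp: Q_def)
    finally show "(P * Q) $$ (i, j) = 1\<^sub>m ?N $$ (i, j)" .
  qed (use carr in auto)
  have QP: "Q * P = 1\<^sub>m ?N" using mat_mult_left_right_inverse carr PQ by blast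
  have AP: "A * P = P * C"
  proof (rule eq_matI)
    fix i j assume "i < dim_row (P * C)" "j < dim_col (P * C)"
    then have ij: "i < ?N" "j < ?N" using carr by auto
    have "(P * C) $$ (i, j) = (\<Sum>k = 0..<?N. P $$ (i, k) * C $$ (k, j))"
      using ij carr by (simp add: scalar_prod_def)
    also have "\<dots> = (\<Sum>k = 0..<?N. (if k = 0 then C $$ (k, j) else 0) +
        (if k = i then if k = 0 then 0 else C $$ (k, j) else 0))"
      by (intro sum.cong refl) (use ij in \<open>auto simp: P_def\<close>)
    also have "\<dots> = C $$ (0, j) + (if i = 0 then 0 else C $$ (i, j))"
      using ij by (simp add: sum.distrib del: sum.op_ivl_Suc)
    also have "\<dots> = (if j = 0 then r else A $$ (i, j))" using ij by (auto simp: C)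
    finally have PC: "(P * C) $$ (i, j) = (if j = 0 then r else A $$ (i, j))" .
    have "(A * P) $$ (i, j) = (\<Sum>k = 0..<?N. A $$ (i, k) * P $$ (k, j))"
      using ij carr A by (simp add: scalar_prod_def)
    also have "\<dots> = (if j = 0 then r else A $$ (i, j))"
    proof (cases "j = 0")
      case True
      then have "(\<Sum>k = 0..<?N. A $$ (i, k) * P $$ (k, j)) = (\<Sum>k<?N. A $$ (i, k))"
        by (intro sum.cong) (auto simp: P_def)
      then show ?thesis using True row[of i] ij by simp
    next
      case False
      then have "(\<Sum>k = 0..<?N. A $$ (i, k) * P $$ (k, j)) =
          (\<Sum>k = 0..<?N. if k = j then A $$ (i, k) else 0)"
        by (intro sum.cong) (use ij in \<open>auto simp: P_def\<close>)
      then show ?thesis using False ij by (simp del: sum.op_ivl_Suc)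
    qed
    finally show "(A * P) $$ (i, j) = (P * C) $$ (i, j)" using PC by simp
  qed (use carr A in auto)
  have "A = A * (P * Q)" using A PQ by simp
  also have "\<dots> = P * C * Q" using A carr AP assoc_mult_mat by metis
  finally have "similar_mat_wit A C P Q"
    by (intro similar_mat_witI[where n = ?N]) (use PQ QP carr A in auto)
  then have "char_poly A = char_poly C" by (intro char_poly_similar) (auto simp: similar_mat_def)
  also have "\<dots> = char_poly (mat 1 1 (\<lambda>_. r)) * char_poly B"
    unfolding C_def by (rule char_poly_four_block_zeros_col) (auto simp: B_def)
  also have "char_poly (mat 1 1 (\<lambda>_. r)) = [:- r, 1:]"
    by (simp add: char_poly_defs det_def sign_def)
  finally show ?thesis unfolding B_def .
qed

lemma sorted_list_of_multiset_add_max: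
  assumes "\<And>x. x \<in># M \<Longrightarrow> x \<le> a"
  shows "sorted_list_of_multiset (add_mset a M) = sorted_list_of_multiset M @ [a]"
  using assms by (simp add: sorted_insort_is_snoc)

lemma descending_roots_linear_factor:
  fixes q :: "real poly"
  assumes "q \<noteq> 0" "poly q l = 0" "\<And>t. poly q t = 0 \<Longrightarrow> t \<le> l" "l \<le> r"
  shows "rev (sorted_list_of_multiset (proots ([:- r, 1:] * q))) ! 0 = r"
    and "rev (sorted_list_of_multiset (proots ([:- r, 1:] * q))) ! 1 = l"
proof -
  define M where "M = proots q - {#l#}"
  have roots: "proots q = add_mset l M"
    unfolding M_def using assms(1,2) by simp
  have M: "t \<le> l" if "t \<in># M" for t
    using in_diffD[OF that[unfolded M_def]] assms(1,3) by simp
  have "proots [:- r, 1:] = {#r#}"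
    by simp
  then have "proots ([:- r, 1:] * q) = add_mset r (add_mset l M)"
    using assms(1) by (subst proots_mult) (auto simp: roots)
  moreover have "sorted_list_of_multiset (add_mset l M) = sorted_list_of_multiset M @ [l]"
    using M by (rule sorted_list_of_multiset_add_max)
  moreover have "sorted_list_of_multiset (add_mset r (add_mset l M)) = sorted_list_of_multiset (add_mset l M) @ [r]"
    by (rule sorted_list_of_multiset_add_max) (use M assms(4) in force)
  ultimately have *: "rev (sorted_list_of_multiset (proots ([:- r, 1:] * q))) = r # l # rev (sorted_list_of_multiset M)"
    by simp
  show "rev (sorted_list_of_multiset (proots ([:- r, 1:] * q))) ! 0 = r"
    "rev (sorted_list_of_multiset (proots ([:- r, 1:] * q))) ! 1 = l" unfolding * by auto
qed

section \<open>The spectral gap of a connected cubic graph\<close>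

definition adj :: "'a pair_pre_digraph \<Rightarrow> 'a \<Rightarrow> 'a \<Rightarrow> real" where
  "adj G v w = (if (v, w) \<in> parcs G then 1 else 0)"

lemma connected_constant:
  assumes "Digraph_Component.connected (with_proj G)"
    and const: "\<And>v w. (v, w) \<in> parcs G \<Longrightarrow> z v = z w"
    and "v \<in> pverts G" "w \<in> pverts G"
  shows "z v = z w"
proof -
  have "(v, w) \<in> rtrancl_on (pverts G) ((parcs G)\<^sup>s)"
    using assms by (auto simp: connected_conv)
  then show ?thesis
  proof (induction rule: rtrancl_on_induct)
    case (step y z')
    then show ?case using const by (auto simp: symcl_def)
  qed simp
qed

locale connected_cubic =
  fixes G :: "'a pair_pre_digraph"
  assumes graph: "pair_graph G"
    and conn: "Digraph_Component.connected (with_proj G)"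
    and cubic: "cubic G"
begin

sublocale pair_graph G by (rule graph)

abbreviation "V \<equiv> pverts G"

lemma finite_V: "finite V" using pair_finite_verts .

lemma adj_sym: "adj G v w = adj G w v"
  using arcs_symmetric by (auto simp: adj_def)

lemma card_neighbours:
  assumes "v \<in> V"
  shows "card {w. (v, w) \<in> parcs G} = 3"
proof -
  have "card (Pair v ` {w. (v, w) \<in> parcs G}) = card {w. (v, w) \<in> parcs G}"
    by (rule card_image) (auto intro: inj_onI)
  moreover have "Pair v ` {w. (v, w) \<in> parcs G} = out_arcs (with_proj G) v"
    by (auto simp: out_arcs_def)
  ultimately show ?thesis
    using cubic assms by (simp add: cubic_def out_degree_def)
qed

lemma sum_adj: "(\<Sum>w\<in>V. adj G v w * h w) = (\<Sum>w | (v, w) \<in> parcs G. h w)"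
proof -
  have "(\<Sum>w\<in>V. adj G v w * h w) = (\<Sum>w\<in>{w. (v, w) \<in> parcs G}. adj G v w * h w)"
    by (rule sum.mono_neutral_right) (use finite_V in \<open>auto simp: adj_def dest: in_arcsD2\<close>)
  then show ?thesis by (simp add: adj_def)
qed

lemma row_sum_adj: "v \<in> V \<Longrightarrow> (\<Sum>w\<in>V. adj G v w) = 3"
  using sum_adj[of v "\<lambda>_. 1"] card_neighbours by simp

text \<open>
  By \<open>sum_kernel_sq_diff\<close> the nonnegative Dirichlet energy of \<open>z\<close> is at most \<open>0\<close>, so \<open>z\<close> does not change along
  any edge.
\<close>

lemma rayleigh_ge_3_imp_constant:
  assumes ge: "quad_form V (adj G) z \<ge> 3 * (\<Sum>v\<in>V. (z v)\<^sup>2)" and "v \<in> V" "w \<in> V"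
  shows "z v = z w"
proof -
  have "(\<Sum>v\<in>V. \<Sum>w\<in>V. adj G v w * (z v - z w)\<^sup>2) \<le> 0"
    using ge sum_kernel_sq_diff[of V "adj G" 3 z] adj_sym row_sum_adj by simp
  then have "(\<Sum>v\<in>V. \<Sum>w\<in>V. adj G v w * (z v - z w)\<^sup>2) = 0"
    by (intro order_antisym sum_nonneg) (auto simp: adj_def)
  then have zero: "adj G v w * (z v - z w)\<^sup>2 = 0" if "v \<in> V" "w \<in> V" for v w
    using that finite_V by (simp add: sum_nonneg_eq_0_iff sum_nonneg adj_def)
  have "z v = z w" if "(v, w) \<in> parcs G" for v w
    using zero[of v w] that in_arcsD1 in_arcsD2 by (auto simp: adj_def)
  then show ?thesis using connected_constant conn assms(2,3) by metis
qed

lemma rayleigh_less_3: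
  assumes "(\<Sum>v\<in>V. x v) = 0" "\<exists>v\<in>V. x v \<noteq> 0" "quad_form V (adj G) x = l * (\<Sum>v\<in>V. (x v)\<^sup>2)"
  shows "l < 3"
proof (rule ccontr)
  assume "\<not> l < 3"
  then have "quad_form V (adj G) x \<ge> 3 * (\<Sum>v\<in>V. (x v)\<^sup>2)"
    using assms(3) by (simp add: mult_right_mono sum_nonneg)
  then have const: "x v = x w" if "v \<in> V" "w \<in> V" for v w
    using rayleigh_ge_3_imp_constant that by blast
  obtain u where u: "u \<in> V" "x u \<noteq> 0" using assms(2) by blast
  have "(\<Sum>v\<in>V. x v) = (\<Sum>v\<in>V. x u)" by (intro sum.cong refl const) (use u in auto)
  then show False using assms(1) u finite_V by (auto simp: card_gt_0_iff)
qed

text \<open>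
  Deflation writes the characteristic polynomial as \<open>(X - 3) q\<close>. It remains to see that \<open>l\<close> is the
  largest root of \<open>q\<close>. A root other than \<open>3\<close> has an eigenvector with zero sum and is bounded by the
  Rayleigh quotient. If \<open>3\<close> were a root of \<open>q\<close>, then its eigenvector, extended by \<open>0\<close> to the first
  vertex, would be a nonconstant eigenvector of the graph for \<open>3\<close>, against connectivity.
\<close>

theorem spectral_gap_variational:
  assumes V2: "card V \<ge> 2"
    and x: "(\<Sum>v\<in>V. x v) = 0" "\<exists>v\<in>V. x v \<noteq> 0"
    and attained: "quad_form V (adj G) x = l * (\<Sum>v\<in>V. (x v)\<^sup>2)"
    and bound: "\<And>y. (\<Sum>v\<in>V. y v) = 0 \<Longrightarrow> quad_form V (adj G) y \<le> l * (\<Sum>v\<in>V. (y v)\<^sup>2)"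
  shows "spectral_gap G = 3 - l"
proof -
  obtain vs where vs: "distinct vs" "set vs = V" using finite_distinct_list finite_V by blast
  define N where "N = length vs"
  define A where "A = adjacency_matrix G vs"
  obtain m where m: "N = Suc m" using V2 vs by (cases N) (auto simp: N_def distinct_card [symmetric])
  have A: "A \<in> carrier_mat N N" by (simp add: A_def adjacency_matrix_def N_def)
  have Aij: "A $$ (i, j) = adj G (vs ! i) (vs ! j)" if "i < N" "j < N" for i j
    using that by (simp add: A_def adjacency_matrix_def N_def adj_def)
  have bij: "bij_betw ((!) vs) {..<N} V"
    using vs by (intro bij_betw_nth) (auto simp: N_def)
  have to_V: "(\<Sum>j<N. h (vs ! j)) = (\<Sum>v\<in>V. h v)" for h :: "'a \<Rightarrow> real"
    using sum.reindex_bij_betw[OF bij, of h] .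
  have in_V: "vs ! i \<in> V" if "i < N" for i
    using that nth_mem[of i vs] unfolding N_def vs(2) by blast
  define idx where "idx = the_inv_into {..<N} ((!) vs)"
  have idx: "idx (vs ! i) = i" if "i < N" for i
    unfolding idx_def using that bij by (intro the_inv_into_f_f) (auto simp: bij_betw_def)
  have ex_idx: "\<exists>i<N. v = vs ! i" if "v \<in> V" for v
    using that vs by (metis N_def in_set_conv_nth)
  define q where "q = char_poly (mat m m (\<lambda>(i, j). A $$ (Suc i, Suc j) - A $$ (0, Suc j)))"
  have cp: "char_poly A = [:- 3, 1:] * q"
    unfolding q_def
  proof (rule char_poly_deflate_constant_row_sum)
    fix i assume "i \<le> m"
    then show "(\<Sum>j<Suc m. A $$ (i, j)) = 3"
      using to_V[of "adj G (vs ! i)"] row_sum_adj in_V m by (simp add: Aij del: sum.lessThan_Suc)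
  qed (use A m in auto)
  have q0: "q \<noteq> 0" using degree_monic_char_poly[OF A] cp by force
  have l3: "l < 3" using rayleigh_less_3 x attained by blast
  have matvec: "(A *\<^sub>v vec N h) $ i = (\<Sum>w\<in>V. adj G (vs ! i) w * h (idx w))" if "i < N" for i h
  proof -
    have "(A *\<^sub>v vec N h) $ i = (\<Sum>j<N. A $$ (i, j) * h j)"
      using that A by (simp add: scalar_prod_def atLeast0LessThan)
    also have "\<dots> = (\<Sum>j<N. adj G (vs ! i) (vs ! j) * h (idx (vs ! j)))"
      by (intro sum.cong refl) (use that in \<open>auto simp: Aij idx\<close>)
    finally show ?thesis using to_V[of "\<lambda>w. adj G (vs ! i) w * h (idx w)"] by simp
  qed
  have eigen: "(\<Sum>w\<in>V. adj G v w * x w) = l * x v" if "v \<in> V" for v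
    using maximiser_is_eigenvector[OF finite_V adj_sym row_sum_adj bound x(1) attained that] by blast
  have "eigenvalue A l"
  proof -
    have "A *\<^sub>v vec N (\<lambda>i. x (vs ! i)) = l \<cdot>\<^sub>v vec N (\<lambda>i. x (vs ! i))"
    proof (rule eq_vecI)
      fix i assume "i < dim_vec (l \<cdot>\<^sub>v vec N (\<lambda>i. x (vs ! i)))"
      then have i: "i < N" by simp
      have "(\<Sum>w\<in>V. adj G (vs ! i) w * x (vs ! idx w)) = (\<Sum>w\<in>V. adj G (vs ! i) w * x w)"
        by (intro sum.cong refl) (metis ex_idx idx)
      then show "(A *\<^sub>v vec N (\<lambda>i. x (vs ! i))) $ i = (l \<cdot>\<^sub>v vec N (\<lambda>i. x (vs ! i))) $ i"
        using i matvec[OF i] eigen in_V by simp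
    qed (use A in auto)
    moreover have "vec N (\<lambda>i. x (vs ! i)) \<noteq> 0\<^sub>v N"
    proof
      assume "vec N (\<lambda>i. x (vs ! i)) = 0\<^sub>v N"
      then have "x (vs ! i) = 0" if "i < N" for i
        using that by (metis index_vec index_zero_vec(1))
      then show False using x(2) ex_idx by metis
    qed
    moreover have "vec N (\<lambda>i. x (vs ! i)) \<in> carrier_vec N" "dim_row A = N" using A by auto
    ultimately show ?thesis unfolding eigenvalue_def eigenvector_def by metis
  qed
  then have "poly (char_poly A) l = 0" using eigenvalue_root_char_poly[OF A] by simp
  then have ql: "poly q l = 0" using cp l3 by simp
  have q_le: "t \<le> l" if qt: "poly q t = 0" for t
  proof (cases "t = 3")
    case True
    let ?B = "mat m m (\<lambda>(i, j). A $$ (Suc i, Suc j) - A $$ (0, Suc j))"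
    have B: "?B \<in> carrier_mat m m" by simp
    have "eigenvalue ?B 3" using qt True eigenvalue_root_char_poly[OF B] by (simp add: q_def)
    then obtain b where b: "b \<in> carrier_vec m" "b \<noteq> 0\<^sub>v m" "?B *\<^sub>v b = 3 \<cdot>\<^sub>v b"
      unfolding eigenvalue_def eigenvector_def by auto
    \<comment> \<open>\<open>b\<close> extended by \<open>0\<close> solves the eigenvector equation up to a constant \<open>c\<close>, and \<open>c = 0\<close> by summation\<close>
    define h where "h i = (case i of 0 \<Rightarrow> 0 | Suc j \<Rightarrow> b $ j)" for i
    define z where "z v = h (idx v)" for v
    define c where "c = (A *\<^sub>v vec N h) $ 0"
    have "(A *\<^sub>v vec N h) $ i = 3 * h i + c" if i: "i < N" for i
    proof (cases i)
      case 0
      then show ?thesis by (simp add: h_def c_def)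
    next
      case (Suc k)
      have row: "(A *\<^sub>v vec N h) $ i = (\<Sum>j<m. A $$ (i, Suc j) * b $ j)" if "i < N" for i
      proof -
        have "(A *\<^sub>v vec N h) $ i = (\<Sum>j<N. A $$ (i, j) * h j)"
          using that A by (simp add: scalar_prod_def atLeast0LessThan)
        also have "\<dots> = (\<Sum>j<m. A $$ (i, Suc j) * b $ j)"
          unfolding m sum.lessThan_Suc_shift by (simp add: h_def)
        finally show ?thesis .
      qed
      have "3 * b $ k = (?B *\<^sub>v b) $ k" unfolding b(3) using b(1) Suc i m by simp
      also have "\<dots> = (\<Sum>j<m. (A $$ (Suc k, Suc j) - A $$ (0, Suc j)) * b $ j)"
        using Suc i m b(1) by (simp add: scalar_prod_def atLeast0LessThan)
      also have "\<dots> = (\<Sum>j<m. A $$ (i, Suc j) * b $ j) - (\<Sum>j<m. A $$ (0, Suc j) * b $ j)"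
        unfolding Suc by (simp add: left_diff_distrib sum_subtractf)
      also have "\<dots> = (A *\<^sub>v vec N h) $ i - c"
        unfolding c_def using row[OF i] row[of 0] m by simp
      finally show ?thesis using Suc by (simp add: h_def)
    qed
    then have Az: "(\<Sum>w\<in>V. adj G v w * z w) = 3 * z v + c" if "v \<in> V" for v
      using ex_idx[OF that] matvec[of _ h] idx unfolding z_def by auto
    have "3 * (\<Sum>v\<in>V. z v) = (\<Sum>v\<in>V. \<Sum>w\<in>V. adj G v w * z w)"
      using sum_kernel_image[of V "adj G" 3 z] adj_sym row_sum_adj by simp
    also have "\<dots> = 3 * (\<Sum>v\<in>V. z v) + c * real (card V)"
      by (simp add: Az sum.distrib sum_distrib_left [symmetric])
    finally have "c = 0" using V2 by auto
    then have "quad_form V (adj G) z = 3 * (\<Sum>v\<in>V. (z v)\<^sup>2)"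
      using Az by (intro quad_form_eigenvector) simp
    then have const: "z v = z w" if "v \<in> V" "w \<in> V" for v w
      using rayleigh_ge_3_imp_constant that by simp
    have hz: "h i = h 0" if "i < N" for i
      using const[OF in_V in_V, of i 0] that m idx unfolding z_def by simp
    have "b $ i = 0" if "i < m" for i
      using hz[of "Suc i"] that m by (simp add: h_def)
    then have "b = 0\<^sub>v m" using b(1) by (intro eq_vecI) auto
    then show ?thesis using b(2) by simp
  next
    case False
    have "eigenvalue A t" using qt cp eigenvalue_root_char_poly[OF A] by simp
    then obtain b where b: "b \<in> carrier_vec N" "b \<noteq> 0\<^sub>v N" "A *\<^sub>v b = t \<cdot>\<^sub>v b"
      using A unfolding eigenvalue_def eigenvector_def by auto
    define y where "y v = b $ idx v" for v
    have "b = vec N (\<lambda>i. b $ i)" using b(1) by auto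
    then have Ay: "(\<Sum>w\<in>V. adj G v w * y w) = t * y v" if "v \<in> V" for v
      using ex_idx[OF that] matvec[of _ "\<lambda>i. b $ i"] b idx unfolding y_def by auto
    have "3 * (\<Sum>v\<in>V. y v) = t * (\<Sum>v\<in>V. y v)"
      using sum_kernel_image[of V "adj G" 3 y] adj_sym row_sum_adj
      by (simp add: Ay sum_distrib_left [symmetric])
    then have "(\<Sum>v\<in>V. y v) = 0" using False by auto
    then have "t * (\<Sum>v\<in>V. (y v)\<^sup>2) \<le> l * (\<Sum>v\<in>V. (y v)\<^sup>2)"
      using bound[of y] quad_form_eigenvector[of V "adj G" y t] Ay by simp
    moreover have "(\<Sum>v\<in>V. (y v)\<^sup>2) \<noteq> 0"
    proof
      assume "(\<Sum>v\<in>V. (y v)\<^sup>2) = 0"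
      then have "y v = 0" if "v \<in> V" for v using that finite_V by (simp add: sum_nonneg_eq_0_iff)
      then have "b $ i = 0" if "i < N" for i using that in_V idx unfolding y_def by metis
      then have "b = 0\<^sub>v N" using b(1) by (intro eq_vecI) auto
      then show False using b(2) by simp
    qed
    moreover have "(\<Sum>v\<in>V. (y v)\<^sup>2) \<ge> 0" by (simp add: sum_nonneg)
    ultimately show ?thesis by (simp add: mult_le_cancel_right)
  qed
  have "graph_eigenvalues G = rev (sorted_list_of_multiset (proots ([:- 3, 1:] * q)))"
    using graph_eigenvalues_eq[OF vs] cp by (simp add: A_def)
  then show ?thesis
    using descending_roots_linear_factor[OF q0 ql q_le, of 3] l3 by (simp add: spectral_gap_def)
qed

end

lemma (in connected_cubic) obtain_second_eigenvector:
  assumes "card V \<ge> 2"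
  obtains x where "(\<Sum>v\<in>V. x v) = 0" "\<exists>v\<in>V. x v \<noteq> 0"
    "quad_form V (adj G) x = (3 - spectral_gap G) * (\<Sum>v\<in>V. (x v)\<^sup>2)"
    "\<And>y. (\<Sum>v\<in>V. y v) = 0 \<Longrightarrow> quad_form V (adj G) y \<le> (3 - spectral_gap G) * (\<Sum>v\<in>V. (y v)\<^sup>2)"
    "spectral_gap G > 0"
proof -
  obtain a b where "a \<in> V" "b \<in> V" "a \<noteq> b"
    using assms card_le_Suc0_iff_eq[OF finite_V] by force
  then obtain l x where x: "(\<Sum>v\<in>V. x v) = 0" "\<exists>v\<in>V. x v \<noteq> 0"
    "quad_form V (adj G) x = l * (\<Sum>v\<in>V. (x v)\<^sup>2)"
    and bound: "\<And>y. (\<Sum>v\<in>V. y v) = 0 \<Longrightarrow> quad_form V (adj G) y \<le> l * (\<Sum>v\<in>V. (y v)\<^sup>2)"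
    using ex_maximiser[OF finite_V, of a b "adj G"] by metis
  have gap: "spectral_gap G = 3 - l"
    by (rule spectral_gap_variational[OF assms x bound])
  have "l < 3" by (rule rayleigh_less_3[OF x])
  then show thesis using that[of x] x bound gap by simp
qed

section \<open>Biadjacency patterns and their corner counts\<close>

definition corner :: "(nat \<times> nat) set \<Rightarrow> nat \<Rightarrow> nat \<Rightarrow> nat" where
  "corner E k l = card {(i, j) \<in> E. i \<le> k \<and> j \<le> l}"

text \<open>
  The first \<open>k\<close> rows of a cubic pattern have \<open>3 k\<close> elements, so bounding corner counts from above
  means bounding overhangs from below. Overhangs are easier to compare, because those of the ladder
  are almost all zero.
\<close>

definition overhang :: "(nat \<times> nat) set \<Rightarrow> nat \<Rightarrow> nat \<Rightarrow> nat" where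
  "overhang E k l = card {(i, j) \<in> E. i \<le> k \<and> l < j}"

text \<open>
  A cubic pattern is the biadjacency relation of a cubic bipartite graph whose classes are both
  numbered by \<open>{1..n}\<close>. The only trace of connectivity is \<open>cut\<close>: some edge leaves the set of the first
  \<open>k\<close> vertices of both classes.
\<close>

locale cubic_pattern =
  fixes n :: nat and E :: "(nat \<times> nat) set"
  assumes sub: "E \<subseteq> {1..n} \<times> {1..n}"
    and row: "i \<in> {1..n} \<Longrightarrow> card {j. (i, j) \<in> E} = 3"
    and col: "j \<in> {1..n} \<Longrightarrow> card {i. (i, j) \<in> E} = 3"
    and cut: "1 \<le> k \<Longrightarrow> k < n \<Longrightarrow> \<exists>(i, j) \<in> E. (i \<le> k \<and> k < j) \<or> (j \<le> k \<and> k < i)"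
begin

lemma finite_E: "finite E"
  using sub by (rule finite_subset) simp

lemma converse_pattern: "cubic_pattern n (E\<inverse>)"
proof
  show "E\<inverse> \<subseteq> {1..n} \<times> {1..n}" using sub by auto
  show "\<exists>(i, j) \<in> E\<inverse>. (i \<le> k \<and> k < j) \<or> (j \<le> k \<and> k < i)" if "1 \<le> k" "k < n" for k
    using cut[OF that] by force
qed (simp_all add: row col)

lemma card_rows:
  assumes "I \<subseteq> {1..n}"
  shows "card {(i, j) \<in> E. i \<in> I} = 3 * card I"
proof -
  have "{(i, j) \<in> E. i \<in> I} = Sigma I (\<lambda>i. {j. (i, j) \<in> E})" by auto
  moreover have "finite {j. (i, j) \<in> E}" for i
    by (rule finite_subset[of _ "snd ` E"]) (use finite_E in force)+
  ultimately have "card {(i, j) \<in> E. i \<in> I} = (\<Sum>i\<in>I. card {j. (i, j) \<in> E})"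
    using finite_subset[OF assms] by (simp add: card_SigmaI)
  also have "\<dots> = (\<Sum>i\<in>I. 3)" by (intro sum.cong refl row) (use assms in auto)
  finally show ?thesis by simp
qed

lemma sum_rows: "(\<Sum>(i, j)\<in>E. h i) = 3 * (\<Sum>i=1..n. h i :: real)"
proof -
  have fin: "finite {j. (i, j) \<in> E}" for i
    by (rule finite_subset[of _ "snd ` E"]) (use finite_E in force)+
  have "E = Sigma {1..n} (\<lambda>i. {j. (i, j) \<in> E})" using sub by auto
  then have "(\<Sum>(i, j)\<in>E. h i) = (\<Sum>(i, j)\<in>Sigma {1..n} (\<lambda>i. {j. (i, j) \<in> E}). h i)" by simp
  also have "\<dots> = (\<Sum>i=1..n. \<Sum>j | (i, j) \<in> E. h i)"
    by (rule sum.Sigma [symmetric]) (use fin in auto)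
  also have "\<dots> = (\<Sum>i=1..n. 3 * h i)" by (intro sum.cong refl) (simp add: row)
  finally show ?thesis by (simp add: sum_distrib_left)
qed

lemma corner_plus_overhang:
  assumes "k \<le> n"
  shows "corner E k l + overhang E k l = 3 * k"
proof -
  have "corner E k l + overhang E k l = card ({(i, j) \<in> E. i \<le> k \<and> j \<le> l} \<union> {(i, j) \<in> E. i \<le> k \<and> l < j})"
    unfolding corner_def overhang_def
    by (rule card_Un_disjoint [symmetric]) (auto intro: finite_subset[OF _ finite_E])
  also have "{(i, j) \<in> E. i \<le> k \<and> j \<le> l} \<union> {(i, j) \<in> E. i \<le> k \<and> l < j} = {(i, j) \<in> E. i \<in> {1..k}}"
    using sub by auto
  also have "card \<dots> = 3 * k" using assms by (subst card_rows) auto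
  finally show ?thesis .
qed

lemma corner_le: "corner E k l \<le> k * l"
proof -
  have "corner E k l \<le> card ({1..k} \<times> {1..l})"
    unfolding corner_def by (rule card_mono) (use sub in auto)
  then show ?thesis by simp
qed

end

lemma corner_converse: "corner (E\<inverse>) k l = corner E l k"
proof -
  have "{(i, j) \<in> E\<inverse>. i \<le> k \<and> j \<le> l} = prod.swap ` {(i, j) \<in> E. i \<le> l \<and> j \<le> k}" by force
  then show ?thesis unfolding corner_def by (simp add: card_image)
qed

context cubic_pattern
begin

lemma sum_cols: "(\<Sum>(i, j)\<in>E. h j) = 3 * (\<Sum>j=1..n. h j :: real)"
proof -
  interpret conv: cubic_pattern n "E\<inverse>" by (rule converse_pattern)
  have "(\<Sum>(i, j)\<in>E. h j) = (\<Sum>(i, j)\<in>E\<inverse>. h i)"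
    by (rule sum.reindex_bij_witness[of _ prod.swap prod.swap]) auto
  then show ?thesis using conv.sum_rows by simp
qed

lemma overhang_ge_rows: "k \<le> n \<Longrightarrow> 3 * k \<le> overhang E k l + k * l"
  using corner_plus_overhang[of k l] corner_le[of k l] by linarith

lemma overhang_ge_cols:
  assumes "l \<le> n"
  shows "3 * (n - l) \<le> overhang E k l + (n - k) * (n - l)"
proof -
  interpret conv: cubic_pattern n "E\<inverse>" by (rule converse_pattern)
  have "{(j, i) \<in> E\<inverse>. j \<in> {l<..n}} = prod.swap ` ({(i, j) \<in> E. i \<le> k \<and> l < j} \<union> {(i, j) \<in> E. k < i \<and> l < j})"
    using sub by force
  then have "3 * (n - l) = card ({(i, j) \<in> E. i \<le> k \<and> l < j} \<union> {(i, j) \<in> E. k < i \<and> l < j})"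
    using conv.card_rows[of "{l<..n}"] by (simp add: card_image subset_iff)
  also have "\<dots> \<le> overhang E k l + card {(i, j) \<in> E. k < i \<and> l < j}"
    unfolding overhang_def by (rule card_Un_le)
  also have "card {(i, j) \<in> E. k < i \<and> l < j} \<le> card ({k<..n} \<times> {l<..n})"
    by (rule card_mono) (use sub in auto)
  finally show ?thesis by simp
qed

text \<open>
  Both the elements to the right of the corner and the elements below it are counted by \<open>3 k\<close> minus
  the corner count. By \<open>cut\<close> one of these two sets is nonempty, hence so is the other.
\<close>

lemma overhang_diag_ge_1:
  assumes "1 \<le> k" "k < n"
  shows "1 \<le> overhang E k k"
proof -
  interpret conv: cubic_pattern n "E\<inverse>" by (rule converse_pattern)
  have "overhang E k k = overhang (E\<inverse>) k k"
    using corner_plus_overhang[of k k] conv.corner_plus_overhang[of k k] corner_converse[of E k k] assms by simp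
  moreover have "overhang E k k \<noteq> 0 \<or> overhang (E\<inverse>) k k \<noteq> 0"
  proof -
    obtain i j where "(i, j) \<in> E" "(i \<le> k \<and> k < j) \<or> (j \<le> k \<and> k < i)" using cut assms by blast
    then have "{(i, j) \<in> E. i \<le> k \<and> k < j} \<noteq> {} \<or> {(i, j) \<in> E\<inverse>. i \<le> k \<and> k < j} \<noteq> {}" by auto
    moreover have "finite {(i, j) \<in> E. i \<le> k \<and> k < j}" "finite {(i, j) \<in> E\<inverse>. i \<le> k \<and> k < j}"
      by (auto intro: finite_subset[OF _ finite_E] finite_subset[OF _ conv.finite_E])
    ultimately show ?thesis unfolding overhang_def by (simp only: card_0_eq)
  qed
  ultimately show ?thesis by linarith
qed

text \<open>
  Abel summation in both variables: \<open>a n - a i\<close> is the sum of the increments of \<open>a\<close> at all \<open>k \<ge> i\<close>,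
  so an element \<open>(i, j)\<close> contributes to exactly those \<open>(k, l)\<close> whose corner contains it. The
  remaining terms depend only on the row and column sums.
\<close>

lemma bilinear_eq_corners:
  fixes a b :: "nat \<Rightarrow> real"
  shows "(\<Sum>(i, j)\<in>E. a i * b j) =
    3 * a n * (\<Sum>j=1..n. b j) + 3 * b n * (\<Sum>i=1..n. a i) - 3 * real n * a n * b n
    + (\<Sum>k=1..<n. \<Sum>l=1..<n. (a (Suc k) - a k) * (b (Suc l) - b l) * real (corner E k l))"
proof -
  have tele: "c n - c i = (\<Sum>k=1..<n. if i \<le> k then c (Suc k) - c k else 0)"
    if "i \<in> {1..n}" for c :: "nat \<Rightarrow> real" and i
  proof -
    have "(\<Sum>k=1..<n. if i \<le> k then c (Suc k) - c k else 0) = (\<Sum>k=i..<n. if i \<le> k then c (Suc k) - c k else 0)"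
      by (rule sum.mono_neutral_right) (use that in auto)
    also have "\<dots> = c n - c i" using sum_Suc_diff'[of i n c] that by simp
    finally show ?thesis ..
  qed
  have "(\<Sum>(i, j)\<in>E. (a n - a i) * (b n - b j)) = (\<Sum>e\<in>E. \<Sum>k=1..<n. \<Sum>l=1..<n.
      if fst e \<le> k \<and> snd e \<le> l then (a (Suc k) - a k) * (b (Suc l) - b l) else 0)"
  proof (intro sum.cong refl)
    fix e assume "e \<in> E"
    then have e: "fst e \<in> {1..n}" "snd e \<in> {1..n}" using sub by auto
    have "(a n - a (fst e)) * (b n - b (snd e)) = (\<Sum>k=1..<n. \<Sum>l=1..<n.
      (if fst e \<le> k then a (Suc k) - a k else 0) * (if snd e \<le> l then b (Suc l) - b l else 0))"
      by (simp only: tele[OF e(1)] tele[OF e(2)] sum_product)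
    also have "\<dots> = (\<Sum>k=1..<n. \<Sum>l=1..<n.
      if fst e \<le> k \<and> snd e \<le> l then (a (Suc k) - a k) * (b (Suc l) - b l) else 0)"
      by (intro sum.cong refl) simp
    finally show "(case e of (i, j) \<Rightarrow> (a n - a i) * (b n - b j)) = (\<Sum>k=1..<n. \<Sum>l=1..<n.
      if fst e \<le> k \<and> snd e \<le> l then (a (Suc k) - a k) * (b (Suc l) - b l) else 0)"
      by (simp add: case_prod_unfold)
  qed
  also have "\<dots> = (\<Sum>k=1..<n. \<Sum>l=1..<n. \<Sum>e\<in>E.
      if fst e \<le> k \<and> snd e \<le> l then (a (Suc k) - a k) * (b (Suc l) - b l) else 0)"
    by (subst sum.swap, intro sum.cong refl, rule sum.swap)
  also have "\<dots> = (\<Sum>k=1..<n. \<Sum>l=1..<n. (a (Suc k) - a k) * (b (Suc l) - b l) * real (corner E k l))"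
  proof (intro sum.cong refl)
    fix k l
    have "{e \<in> E. fst e \<le> k \<and> snd e \<le> l} = {(i, j) \<in> E. i \<le> k \<and> j \<le> l}" by auto
    then show "(\<Sum>e\<in>E. if fst e \<le> k \<and> snd e \<le> l then (a (Suc k) - a k) * (b (Suc l) - b l) else 0) =
      (a (Suc k) - a k) * (b (Suc l) - b l) * real (corner E k l)"
      using finite_E by (simp add: sum.If_cases Int_def corner_def)
  qed
  finally have corners: "(\<Sum>(i, j)\<in>E. (a n - a i) * (b n - b j)) =
    (\<Sum>k=1..<n. \<Sum>l=1..<n. (a (Suc k) - a k) * (b (Suc l) - b l) * real (corner E k l))" .
  have "(\<Sum>(i, j)\<in>E. (a n - a i) * (b n - b j)) =
    (\<Sum>(i, j)\<in>E. a n * b n) - b n * (\<Sum>(i, j)\<in>E. a i) - a n * (\<Sum>(i, j)\<in>E. b j) + (\<Sum>(i, j)\<in>E. a i * b j)"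
    by (simp add: case_prod_unfold algebra_simps sum.distrib sum_subtractf sum_distrib_left)
  also have "\<dots> = 3 * real n * a n * b n - b n * (3 * (\<Sum>i=1..n. a i)) - a n * (3 * (\<Sum>j=1..n. b j))
      + (\<Sum>(i, j)\<in>E. a i * b j)"
    using sum_rows[of "\<lambda>_. a n * b n"] sum_rows[of a] sum_cols[of b] by simp
  finally show ?thesis unfolding corners by (simp add: algebra_simps)
qed

end

section \<open>The ladder pattern has the largest corner counts\<close>

text \<open>
  The biadjacency pattern of $H_{2n}$: the tridiagonal band without the two diagonal positions
  \<open>(3, 3)\<close> and \<open>(n - 2, n - 2)\<close>, completed at both ends by two positions off the band.
\<close>

definition ladder :: "nat \<Rightarrow> (nat \<times> nat) set" where
  "ladder n = {(i, j). i \<in> {1..n} \<and> j \<in> {1..n} \<and>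
     (i \<le> Suc j \<and> j \<le> Suc i \<and> (i, j) \<noteq> (3, 3) \<and> (i, j) \<noteq> (n - 2, n - 2) \<or>
      (i, j) \<in> {(1, 3), (3, 1), (n - 2, n), (n, n - 2)})}"

lemma ladder_sym: "(i, j) \<in> ladder n \<longleftrightarrow> (j, i) \<in> ladder n"
  by (auto simp: ladder_def)

lemma ladder_converse: "(ladder n)\<inverse> = ladder n"
  using ladder_sym by auto

lemma ladder_row:
  assumes n: "n \<ge> 6"
  shows "{j. (1, j) \<in> ladder n} = {1, 2, 3}" "{j. (2, j) \<in> ladder n} = {1, 2, 3}"
    "{j. (3, j) \<in> ladder n} = {1, 2, 4}"
    "4 \<le> i \<Longrightarrow> i \<le> n - 3 \<Longrightarrow> {j. (i, j) \<in> ladder n} = {i - 1, i, Suc i}"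
    "{j. (n - 2, j) \<in> ladder n} = {n - 3, n - 1, n}"
    "{j. (n - 1, j) \<in> ladder n} = {n - 2, n - 1, n}" "{j. (n, j) \<in> ladder n} = {n - 2, n - 1, n}"
proof -
  show "{j. (1, j) \<in> ladder n} = {1, 2, 3}" using n by (auto simp: ladder_def)
  show "{j. (2, j) \<in> ladder n} = {1, 2, 3}"
    by (rule Set.set_eqI) (use n in \<open>simp add: ladder_def; presburger\<close>)
  show "{j. (3, j) \<in> ladder n} = {1, 2, 4}"
    by (rule Set.set_eqI) (use n in \<open>simp add: ladder_def; presburger\<close>)
  show "{j. (i, j) \<in> ladder n} = {i - 1, i, Suc i}" if i: "4 \<le> i" "i \<le> n - 3"
  proof -
    have ne: "i \<noteq> 1" "i \<noteq> 3" "i \<noteq> n - 2" "i \<noteq> n" "1 \<le> i" "i \<le> n" using i n by linarith+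
    have "(i, j) \<in> ladder n \<longleftrightarrow> i \<le> Suc j \<and> j \<le> Suc i" for j
    proof -
      have "j \<in> {1..n}" if "i \<le> Suc j" "j \<le> Suc i" using that i by auto
      then show ?thesis using ne by (auto simp: ladder_def)
    qed
    then have "{j. (i, j) \<in> ladder n} = {j. i \<le> Suc j \<and> j \<le> Suc i}" by simp
    also have "\<dots> = {i - 1, i, Suc i}" using i by auto
    finally show ?thesis .
  qed
  show "{j. (n - 2, j) \<in> ladder n} = {n - 3, n - 1, n}"
    by (rule Set.set_eqI) (use n in \<open>simp add: ladder_def; presburger\<close>)
  show "{j. (n - 1, j) \<in> ladder n} = {n - 2, n - 1, n}" using n by (auto simp: ladder_def)
  show "{j. (n, j) \<in> ladder n} = {n - 2, n - 1, n}" using n by (auto simp: ladder_def)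
qed

lemma ladder_index_cases:
  fixes n i :: nat
  assumes n: "n \<ge> 6" and i: "i \<in> {1..n}"
  obtains "i = 1" | "i = 2" | "i = 3" | "4 \<le> i" "i \<le> n - 3" | "i = n - 2" | "i = n - 1" | "i = n"
proof -
  have "i = 1 \<or> i = 2 \<or> i = 3 \<or> (4 \<le> i \<and> i \<le> n - 3) \<or> i = n - 2 \<or> i = n - 1 \<or> i = n"
    using i n by simp presburger
  then show thesis using that by blast
qed

lemma ladder_cubic_pattern:
  assumes n: "n \<ge> 6"
  shows "cubic_pattern n (ladder n)"
proof
  show "ladder n \<subseteq> {1..n} \<times> {1..n}" by (auto simp: ladder_def)
  show row: "card {j. (i, j) \<in> ladder n} = 3" if "i \<in> {1..n}" for i
    using n that
  proof (cases rule: ladder_index_cases)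
    case 4
    then show ?thesis using ladder_row(4)[OF n, of i] by (auto simp: card_insert_if)
  qed (use n in \<open>simp_all only: ladder_row[OF n], auto simp: card_insert_if\<close>)
  show "card {i. (i, j) \<in> ladder n} = 3" if "j \<in> {1..n}" for j
    using row[OF that] by (simp add: ladder_sym)
  show "\<exists>(i, j) \<in> ladder n. (i \<le> k \<and> k < j) \<or> (j \<le> k \<and> k < i)" if "1 \<le> k" "k < n" for k
    by (rule bexI[of _ "(k, Suc k)"]) (use that in \<open>auto simp: ladder_def\<close>)
qed

lemma ladder_overhang_subset:
  assumes n: "n \<ge> 6" and kl: "1 \<le> k" "k \<le> l" "l < n"
  shows "{(i, j) \<in> ladder n. i \<le> k \<and> l < j} \<subseteq>
    (if k = l then {(k, Suc k)} else {}) \<union> (if k \<le> 2 \<and> l \<le> 2 then {(1, 3)} else {})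
    \<union> (if n - 2 \<le> k then {(n - 2, n)} else {})" (is "_ \<subseteq> ?R")
proof (rule subsetI)
  fix e assume "e \<in> {(i, j) \<in> ladder n. i \<le> k \<and> l < j}"
  then obtain i j where e: "e = (i, j)" and ij: "(i, j) \<in> ladder n" "i \<le> k" "l < j" by auto
  then have "i < j" using kl by linarith
  then consider "j = Suc i" | "i = 1" "j = 3" | "i = n - 2" "j = n"
    using ij(1) n by (auto simp: ladder_def)
  then show "e \<in> ?R"
  proof cases
    case 1
    then have "i = k" "k = l" using ij kl by linarith+
    then show ?thesis using 1 e by simp
  next
    case 2
    then have "k \<le> 2" "l \<le> 2" using ij kl by linarith+
    then show ?thesis using 2 e by simp
  next
    case 3
    then have "n - 2 \<le> k" using ij by linarith
    then show ?thesis using 3 e by simp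
  qed
qed

text \<open>
  For \<open>k \<le> l\<close> the overhang of the ladder is at most \<open>2\<close>, and it is nonzero only on the diagonal and at
  \<open>(1, 2)\<close> and \<open>(n - 2, n - 1)\<close>. Near the upper left end the lower bound comes from the \<open>k l\<close> places of
  the corner, near the lower right end from the \<open>(n - k) (n - l)\<close> places of the opposite corner, and on
  the rest of the diagonal from connectivity.
\<close>

lemma (in cubic_pattern) ladder_overhang_le:
  assumes n: "n \<ge> 6" and kl: "1 \<le> k" "k \<le> l" "l < n"
  shows "overhang (ladder n) k l \<le> overhang E k l"
proof -
  let ?S = "(if k = l then {(k, Suc k)} else {}) \<union> (if k \<le> 2 \<and> l \<le> 2 then {(1, 3)} else {})
    \<union> (if n - 2 \<le> k then {(n - 2, n)} else {})"
  have "overhang (ladder n) k l \<le> card ?S"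
    unfolding overhang_def by (rule card_mono[OF _ ladder_overhang_subset]) (use n kl in auto)
  also have "\<dots> \<le> (if k = l then 1 else 0) + (if k \<le> 2 \<and> l \<le> 2 then 1 else 0) + (if n - 2 \<le> k then 1 else 0)"
    by (intro order_trans[OF card_Un_le] add_mono) auto
  also have "\<dots> \<le> overhang E k l"
  proof -
    consider "k = 1" | "k = 2" | "k = n - 2" | "k = n - 1" | "2 < k" "k < n - 2"
      using kl by linarith
    then show ?thesis
    proof cases
      case 1
      then show ?thesis
        using overhang_ge_rows[of k l] n kl by (cases "l = 1"; cases "l = 2") auto
    next
      case 2
      then show ?thesis
        using overhang_ge_rows[of k l] n kl by (cases "l = 2") auto
    next
      case 3
      then have k: "n - k = 2" "\<not> k \<le> 2" using n by linarith+
      consider "l = k" "n - l = 2" | "l \<noteq> k" "n - l = 1" using 3 kl by linarith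
      then show ?thesis
      proof cases
        case 1
        then show ?thesis using overhang_ge_cols[of l k] k kl(3) by simp
      next
        case 2
        then show ?thesis using overhang_ge_cols[of l k] k kl(3) by simp
      qed
    next
      case 4
      then have k: "n - k = 1" "\<not> k \<le> 2" "l = k" using n kl by linarith+
      then show ?thesis using overhang_ge_cols[of l k] kl(3) by simp
    next
      case 5
      then show ?thesis using overhang_diag_ge_1[of k] kl by auto
    qed
  qed
  finally show ?thesis .
qed

text \<open>
  Above the diagonal this is the comparison of overhangs; below it, transpose.
\<close>

lemma (in cubic_pattern) corner_le_ladder:
  assumes n: "n \<ge> 6" and kl: "1 \<le> k" "k < n" "1 \<le> l" "l < n"
  shows "corner E k l \<le> corner (ladder n) k l"
proof -
  interpret L: cubic_pattern n "ladder n" using n by (rule ladder_cubic_pattern)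
  interpret conv: cubic_pattern n "E\<inverse>" by (rule converse_pattern)
  show ?thesis
  proof (cases "k \<le> l")
    case True
    then show ?thesis
      using ladder_overhang_le[OF n kl(1) True kl(4)] corner_plus_overhang[of k l] L.corner_plus_overhang[of k l] kl
      by linarith
  next
    case False
    then have "corner (E\<inverse>) l k \<le> corner ((ladder n)\<inverse>) l k"
      unfolding ladder_converse
      using conv.ladder_overhang_le[of l k] conv.corner_plus_overhang[of l k] L.corner_plus_overhang[of l k] kl n
      by linarith
    then show ?thesis by (simp only: corner_converse)
  qed
qed

text \<open>
  The difference of the two sums is a sum of nonnegative terms, one for each corner. Equality
  therefore makes the corner counts agree wherever both sequences increase.
\<close>

lemma (in cubic_pattern) bilinear_le_ladder:
  fixes a b :: "nat \<Rightarrow> real"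
  assumes n: "n \<ge> 6"
    and a: "\<And>k. 1 \<le> k \<Longrightarrow> k < n \<Longrightarrow> a k \<le> a (Suc k)"
    and b: "\<And>k. 1 \<le> k \<Longrightarrow> k < n \<Longrightarrow> b k \<le> b (Suc k)"
  shows "(\<Sum>(i, j)\<in>E. a i * b j) \<le> (\<Sum>(i, j)\<in>ladder n. a i * b j)"
    and "(\<Sum>(i, j)\<in>E. a i * b j) = (\<Sum>(i, j)\<in>ladder n. a i * b j) \<Longrightarrow>
      1 \<le> k \<Longrightarrow> k < n \<Longrightarrow> a k < a (Suc k) \<Longrightarrow> 1 \<le> l \<Longrightarrow> l < n \<Longrightarrow> b l < b (Suc l) \<Longrightarrow>
      corner E k l = corner (ladder n) k l"
proof -
  interpret L: cubic_pattern n "ladder n" using n by (rule ladder_cubic_pattern)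
  define T where "T k l = (a (Suc k) - a k) * (b (Suc l) - b l)
    * (real (corner (ladder n) k l) - real (corner E k l))" for k l
  have T0: "T k l \<ge> 0" if "k \<in> {1..<n}" "l \<in> {1..<n}" for k l
    using that a[of k] b[of l] corner_le_ladder[OF n, of k l] unfolding T_def by (intro mult_nonneg_nonneg) auto
  have diff: "(\<Sum>(i, j)\<in>ladder n. a i * b j) - (\<Sum>(i, j)\<in>E. a i * b j) = (\<Sum>k=1..<n. \<Sum>l=1..<n. T k l)"
    unfolding bilinear_eq_corners[of a b] L.bilinear_eq_corners[of a b] T_def
    by (simp add: right_diff_distrib sum_subtractf)
  have "(\<Sum>k=1..<n. \<Sum>l=1..<n. T k l) \<ge> 0" by (intro sum_nonneg T0)
  then show "(\<Sum>(i, j)\<in>E. a i * b j) \<le> (\<Sum>(i, j)\<in>ladder n. a i * b j)" using diff by simp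
  assume eq: "(\<Sum>(i, j)\<in>E. a i * b j) = (\<Sum>(i, j)\<in>ladder n. a i * b j)"
    and kl: "1 \<le> k" "k < n" "a k < a (Suc k)" "1 \<le> l" "l < n" "b l < b (Suc l)"
  have "(\<Sum>k=1..<n. \<Sum>l=1..<n. T k l) = 0" using diff eq by simp
  then have "(\<Sum>l=1..<n. T k l) = 0"
    using kl T0 by (subst (asm) sum_nonneg_eq_0_iff) (auto intro: sum_nonneg)
  then have "T k l = 0"
    using kl T0 by (subst (asm) sum_nonneg_eq_0_iff) auto
  then show "corner E k l = corner (ladder n) k l" using kl by (simp add: T_def)
qed

text \<open>
  Inclusion and exclusion: membership is the mixed second difference of the corner counts.
\<close>

lemma corner_Suc_Suc:
  assumes "finite E"
  shows "corner E (Suc k) (Suc l) + corner E k l =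
    corner E k (Suc l) + corner E (Suc k) l + (if (Suc k, Suc l) \<in> E then 1 else 0)"
proof -
  define X where "X = {(i, j) \<in> E. i \<le> k \<and> j \<le> Suc l}"
  define Y where "Y = {(i, j) \<in> E. i \<le> Suc k \<and> j \<le> l}"
  have fin: "finite X" "finite Y" unfolding X_def Y_def by (auto intro: finite_subset[OF _ assms])
  have "X \<inter> Y = {(i, j) \<in> E. i \<le> k \<and> j \<le> l}" by (auto simp: X_def Y_def)
  moreover have "{(i, j) \<in> E. i \<le> Suc k \<and> j \<le> Suc l} =
      (if (Suc k, Suc l) \<in> E then insert (Suc k, Suc l) (X \<union> Y) else X \<union> Y)"
    by (auto simp: X_def Y_def le_Suc_eq)
  moreover have "(Suc k, Suc l) \<notin> X \<union> Y" by (auto simp: X_def Y_def)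
  moreover have "card X + card Y = card (X \<union> Y) + card (X \<inter> Y)" by (rule card_Un_Int[OF fin])
  ultimately show ?thesis using fin unfolding corner_def X_def [symmetric] Y_def [symmetric] by simp
qed

text \<open>
  An element with \<open>j \<ge> i + 2\<close> outside the ladder would lie in an overhang that is empty for the
  ladder, and transposition excludes \<open>i \<ge> j + 2\<close>. Of the positions with \<open>\<bar>i - j\<bar> \<le> 1\<close> the ladder misses
  only \<open>(3, 3)\<close> and \<open>(n - 2, n - 2)\<close>, and there the second difference of the corner counts decides.
  Hence the pattern is contained in the ladder, and both have \<open>3 n\<close> elements.
\<close>

lemma (in cubic_pattern) eq_ladder_if_corners_eq:
  assumes n: "n \<ge> 6"
    and eq: "\<And>k l. 2 \<le> k \<Longrightarrow> k \<le> n - 2 \<Longrightarrow> 2 \<le> l \<Longrightarrow> l \<le> n - 2 \<Longrightarrow> corner E k l = corner (ladder n) k l"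
  shows "E = ladder n"
proof -
  interpret L: cubic_pattern n "ladder n" using n by (rule ladder_cubic_pattern)
  have outside: "(i, j) \<in> ladder n" if ij: "(i, j) \<in> F" "i + 2 \<le> j" and F: "cubic_pattern n F"
    and eqF: "\<And>k l. 2 \<le> k \<Longrightarrow> k \<le> n - 2 \<Longrightarrow> 2 \<le> l \<Longrightarrow> l \<le> n - 2 \<Longrightarrow> corner F k l = corner (ladder n) k l"
    for F i j
  proof (rule ccontr)
    interpret F: cubic_pattern n F by (rule F)
    assume "(i, j) \<notin> ladder n"
    moreover have range: "1 \<le> i" "j \<le> n" using ij F.sub by auto
    ultimately have ne: "(i, j) \<noteq> (1, 3)" "(i, j) \<noteq> (n - 2, n)" using n by (auto simp: ladder_def)
    \<comment> \<open>a corner boundary with indices in \<open>{2..n - 2}\<close> that separates row \<open>i\<close> from column \<open>j\<close>\<close>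
    define k where "k = max i 2"
    define l where "l = min (j - 1) (n - 2)"
    have kl: "2 \<le> k" "k < l" "l \<le> n - 2" "i \<le> k" "l < j"
      using ij(2) ne range n unfolding k_def l_def by (auto simp: max_def min_def)
    have "overhang F k l = overhang (ladder n) k l"
      using eqF[of k l] F.corner_plus_overhang[of k l] L.corner_plus_overhang[of k l] kl n by linarith
    also have "\<dots> = 0"
    proof -
      have "{(i, j) \<in> ladder n. i \<le> k \<and> l < j} = {}"
        using ladder_overhang_subset[OF n, of k l] kl n by (simp split: if_splits)
      then show ?thesis by (simp only: overhang_def card.empty)
    qed
    finally have "{(i, j) \<in> F. i \<le> k \<and> l < j} = {}"
      unfolding overhang_def
      by (subst (asm) card_0_eq) (auto intro: finite_subset[OF _ F.finite_E])
    then show False using ij kl by auto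
  qed
  have "(i, j) \<in> ladder n" if ij: "(i, j) \<in> E" for i j
  proof -
    have range: "1 \<le> i" "i \<le> n" "1 \<le> j" "j \<le> n" using ij sub by auto
    consider "i + 2 \<le> j" | "j + 2 \<le> i" | "i = j" "i \<in> {3..n - 2}"
      | "i \<le> Suc j" "j \<le> Suc i" "i = j \<Longrightarrow> i \<notin> {3..n - 2}"
      by fastforce
    then show ?thesis
    proof cases
      case 1
      then show ?thesis using outside ij cubic_pattern_axioms eq by blast
    next
      case 2
      have "(j, i) \<in> ladder n"
      proof (rule outside[OF _ 2 converse_pattern])
        show "corner (E\<inverse>) k l = corner (ladder n) k l" if "2 \<le> k" "k \<le> n - 2" "2 \<le> l" "l \<le> n - 2" for k l
          using eq[of l k] that corner_converse[of "ladder n" k l] by (simp add: corner_converse ladder_converse)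
      qed (use ij in auto)
      then show ?thesis by (simp add: ladder_sym)
    next
      case 3
      then obtain k where k: "i = Suc k" "2 \<le> k" "k \<le> n - 3" by (cases i) auto
      have "corner E k k = corner (ladder n) k k" "corner E k (Suc k) = corner (ladder n) k (Suc k)"
        "corner E (Suc k) k = corner (ladder n) (Suc k) k"
        "corner E (Suc k) (Suc k) = corner (ladder n) (Suc k) (Suc k)"
        by (rule eq; use k n in linarith)+
      then have "(if (Suc k, Suc k) \<in> E then 1 else 0 :: nat) = (if (Suc k, Suc k) \<in> ladder n then 1 else 0)"
        using corner_Suc_Suc[OF finite_E, of k k] corner_Suc_Suc[OF L.finite_E, of k k] by linarith
      then show ?thesis using ij 3 k by (auto split: if_splits)
    next
      case 4
      then show ?thesis using range n by (auto simp: ladder_def)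
    qed
  qed
  then have "E \<subseteq> ladder n" by auto
  moreover have "card E = card (ladder n)"
  proof -
    have "card {(i, j) \<in> E. i \<in> {1..n}} = card {(i, j) \<in> ladder n. i \<in> {1..n}}"
      by (simp only: card_rows[OF order_refl] L.card_rows[OF order_refl])
    moreover have "{(i, j) \<in> E. i \<in> {1..n}} = E" "{(i, j) \<in> ladder n. i \<in> {1..n}} = ladder n"
      using sub L.sub by auto
    ultimately show ?thesis by simp
  qed
  ultimately show ?thesis using card_subset_eq[OF L.finite_E] by blast
qed

section \<open>The second eigenvector of the ladder\<close>

lemma sum_ladder_row:
  fixes h :: "nat \<Rightarrow> real"
  assumes n: "n \<ge> 6"
  shows "(\<Sum>j | (1, j) \<in> ladder n. h j) = h 1 + h 2 + h 3"
    and "(\<Sum>j | (2, j) \<in> ladder n. h j) = h 1 + h 2 + h 3"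
    and "(\<Sum>j | (3, j) \<in> ladder n. h j) = h 1 + h 2 + h 4"
    and "4 \<le> i \<Longrightarrow> i \<le> n - 3 \<Longrightarrow> (\<Sum>j | (i, j) \<in> ladder n. h j) = h (i - 1) + h i + h (Suc i)"
    and "(\<Sum>j | (n - 2, j) \<in> ladder n. h j) = h (n - 3) + h (n - 1) + h n"
    and "(\<Sum>j | (n - 1, j) \<in> ladder n. h j) = h (n - 2) + h (n - 1) + h n"
    and "(\<Sum>j | (n, j) \<in> ladder n. h j) = h (n - 2) + h (n - 1) + h n"
proof -
  have three: "sum h {p, q, r} = h p + h q + h r" if "p \<noteq> q" "p \<noteq> r" "q \<noteq> r" for p q r :: nat
    using that by simp
  show "(\<Sum>j | (1, j) \<in> ladder n. h j) = h 1 + h 2 + h 3"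
    unfolding ladder_row[OF n] by (rule three) simp_all
  show "(\<Sum>j | (2, j) \<in> ladder n. h j) = h 1 + h 2 + h 3"
    unfolding ladder_row[OF n] by (rule three) simp_all
  show "(\<Sum>j | (3, j) \<in> ladder n. h j) = h 1 + h 2 + h 4"
    unfolding ladder_row[OF n] by (rule three) simp_all
  show "(\<Sum>j | (i, j) \<in> ladder n. h j) = h (i - 1) + h i + h (Suc i)" if "4 \<le> i" "i \<le> n - 3"
    unfolding ladder_row(4)[OF n that] by (rule three) (use that in linarith)+
  show "(\<Sum>j | (n - 2, j) \<in> ladder n. h j) = h (n - 3) + h (n - 1) + h n"
    unfolding ladder_row[OF n] by (rule three) (use n in linarith)+
  show "(\<Sum>j | (n - 1, j) \<in> ladder n. h j) = h (n - 2) + h (n - 1) + h n"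
    unfolding ladder_row[OF n] by (rule three) (use n in linarith)+
  show "(\<Sum>j | (n, j) \<in> ladder n. h j) = h (n - 2) + h (n - 1) + h n"
    unfolding ladder_row[OF n] by (rule three) (use n in linarith)+
qed

text \<open>
  Maximum principle: look at a position \<open>m\<close> where \<open>\<bar>d\<bar>\<close> is maximal. A row that contains its diagonal
  position gives \<open>(l + 1) \<bar>d m\<bar> \<le> 2 \<bar>d m\<bar>\<close>. The rows \<open>3\<close> and \<open>n - 2\<close> do not, but two of their three
  entries belong to twin rows at the end, where \<open>d\<close> is at most a quarter of the maximum.
\<close>

lemma ladder_no_eigenvalue_below_minus_2:
  fixes d :: "nat \<Rightarrow> real"
  assumes n: "n \<ge> 6" and l: "l > 2"
    and eig: "\<And>i. i \<in> {1..n} \<Longrightarrow> (\<Sum>j | (i, j) \<in> ladder n. d j) = - l * d i"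
    and i: "i \<in> {1..n}"
  shows "d i = 0"
proof -
  have pts: "1 \<in> {1..n}" "2 \<in> {1..n}" "3 \<in> {1..n}" "n - 2 \<in> {1..n}" "n - 1 \<in> {1..n}" "n \<in> {1..n}"
    using n by auto
  define M where "M = Max ((\<lambda>i. \<bar>d i\<bar>) ` {1..n})"
  have M: "\<bar>d i\<bar> \<le> M" if "i \<in> {1..n}" for i
    unfolding M_def by (rule Max_ge) (use that in auto)
  have "M \<in> (\<lambda>i. \<bar>d i\<bar>) ` {1..n}" unfolding M_def by (rule Max_in) (use n in auto)
  then obtain m where m: "m \<in> {1..n}" "\<bar>d m\<bar> = M" by auto
  have M0: "M \<ge> 0" using m(2) by linarith
  have l2: "l * M \<ge> 2 * M" using l M0 by (intro mult_right_mono) auto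
  have own: "M \<le> 0" if "- l * d m = d m + p + q" "\<bar>p\<bar> \<le> M" "\<bar>q\<bar> \<le> M" for p q
  proof -
    have "(l + 1) * d m = - (p + q)" using that(1) by (simp add: algebra_simps)
    moreover have "\<bar>(l + 1) * d m\<bar> = (l + 1) * M" using m(2) l by (simp add: abs_mult)
    ultimately have "(l + 1) * M = \<bar>p + q\<bar>" by (simp only: abs_minus_cancel)
    then have "l * M + M \<le> 2 * M" using that by (simp add: algebra_simps)
    then show ?thesis using l2 by linarith
  qed
  have own3: "M \<le> 0" if "- l * d m = p + q + r" "4 * \<bar>p\<bar> \<le> M" "4 * \<bar>q\<bar> \<le> M" "\<bar>r\<bar> \<le> M" for p q r
  proof -
    have "\<bar>- l * d m\<bar> = l * M" using m(2) l by (simp add: abs_mult)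
    then have "l * M = \<bar>p + q + r\<bar>" using that(1) by simp
    then show ?thesis using l2 that by linarith
  qed
  have twin: "4 * \<bar>p\<bar> \<le> M" if "- l * p = p + p + r" "\<bar>r\<bar> \<le> M" for p r
  proof -
    have "(l + 2) * p = - r" using that(1) by (simp add: algebra_simps)
    moreover have "\<bar>(l + 2) * p\<bar> = (l + 2) * \<bar>p\<bar>" using l by (simp add: abs_mult)
    ultimately have "(l + 2) * \<bar>p\<bar> = \<bar>r\<bar>" by (simp only: abs_minus_cancel)
    moreover have "4 * \<bar>p\<bar> \<le> (l + 2) * \<bar>p\<bar>" using l by (intro mult_right_mono) auto
    ultimately show ?thesis using that(2) by linarith
  qed
  \<comment> \<open>rows \<open>1\<close> and \<open>2\<close> of the ladder are equal, and so are rows \<open>n - 1\<close> and \<open>n\<close>\<close>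
  have low: "d 1 = d 2" using eig[OF pts(1)] eig[OF pts(2)] l unfolding sum_ladder_row[OF n] by simp
  have high: "d (n - 1) = d n" using eig[OF pts(5)] eig[OF pts(6)] l unfolding sum_ladder_row[OF n] by simp
  have "M \<le> 0" using n m(1)
  proof (cases rule: ladder_index_cases)
    case 1
    then show ?thesis using eig[OF pts(1)] M[OF pts(2)] M[OF pts(3)] own[of "d 2" "d 3"]
      unfolding sum_ladder_row[OF n] by simp
  next
    case 2
    then show ?thesis using eig[OF pts(2)] M[OF pts(1)] M[OF pts(3)] own[of "d 1" "d 3"]
      unfolding sum_ladder_row[OF n] by simp
  next
    case 3
    have "4 * \<bar>d 1\<bar> \<le> M" using twin[of "d 1" "d 3"] eig[OF pts(1)] M[OF pts(3)] low
      unfolding sum_ladder_row[OF n] by simp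
    then show ?thesis using 3 eig[OF pts(3)] low own3[of "d 1" "d 2" "d 4"] M[of 4] n
      unfolding sum_ladder_row[OF n] by simp
  next
    case 4
    then have "m - 1 \<in> {1..n}" "Suc m \<in> {1..n}" using n by auto
    then show ?thesis using eig[OF m(1)] own[of "d (m - 1)" "d (Suc m)"] M[of "m - 1"] M[of "Suc m"]
      unfolding sum_ladder_row(4)[OF n 4] by linarith
  next
    case 5
    have "4 * \<bar>d n\<bar> \<le> M" using twin[of "d n" "d (n - 2)"] eig[OF pts(6)] M[OF pts(4)] high
      unfolding sum_ladder_row[OF n] by simp
    then show ?thesis using 5 eig[OF pts(4)] high own3[of "d (n - 1)" "d n" "d (n - 3)"] M[of "n - 3"] n
      unfolding sum_ladder_row[OF n] by simp
  next
    case 6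
    then show ?thesis using eig[OF pts(5)] M[OF pts(4)] M[OF pts(6)] own[of "d (n - 2)" "d n"]
      unfolding sum_ladder_row[OF n] by simp
  next
    case 7
    then show ?thesis using eig[OF pts(6)] M[OF pts(4)] M[OF pts(5)] own[of "d (n - 2)" "d (n - 1)"]
      unfolding sum_ladder_row[OF n] by simp
  qed
  then show ?thesis using M[OF i] by simp
qed

lemma partial_sum_neg:
  fixes a :: "nat \<Rightarrow> real"
  assumes mono: "\<And>k. 1 \<le> k \<Longrightarrow> k < n \<Longrightarrow> a k \<le> a (Suc k)"
    and sum0: "(\<Sum>i=1..n. a i) = 0" and nz: "i \<in> {1..n}" "a i \<noteq> 0"
    and k: "1 \<le> k" "k < n"
  shows "(\<Sum>i=1..k. a i) < 0"
proof -
  have le: "a i \<le> a j" if "1 \<le> i" "i \<le> j" "j \<le> n" for i j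
    using that(2,3)
  proof (induction j rule: dec_induct)
    case (step m)
    then show ?case using mono[of m] that(1) by simp
  qed simp
  show ?thesis
  proof (cases "a k > 0")
    case True
    have split: "(\<Sum>i=1..n. a i) = (\<Sum>i=1..k. a i) + (\<Sum>i\<in>{k<..n}. a i)"
      using k by (subst sum.union_disjoint [symmetric]) (auto intro: sum.cong)
    have "(\<Sum>i\<in>{k<..n}. a i) > 0"
    proof (rule sum_pos)
      fix i assume "i \<in> {k<..n}"
      then show "0 < a i" using le[of k i] True k by auto
    qed (use k in auto)
    then show ?thesis using split sum0 by linarith
  next
    case False
    have "a 1 < 0"
    proof (rule ccontr)
      assume "\<not> a 1 < 0"
      then have nn: "a j \<ge> 0" if "j \<in> {1..n}" for j using le[of 1 j] that by auto
      have "a i = 0" using sum_nonneg_eq_0_iff[of "{1..n}" a] nn sum0 nz(1) by blast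
      then show False using nz(2) by simp
    qed
    have "(\<Sum>i=1..k. a i) = a 1 + (\<Sum>i=Suc 1..k. a i)" using k by (subst sum.atLeast_Suc_atMost) auto
    moreover have "(\<Sum>i=Suc 1..k. a i) \<le> 0"
    proof (rule sum_nonpos)
      fix i assume "i \<in> {Suc 1..k}"
      then show "a i \<le> 0" using le[of i k] k False by auto
    qed
    ultimately show ?thesis using \<open>a 1 < 0\<close> by linarith
  qed
qed

text \<open>
  Summing the eigenvector equation over the first \<open>m\<close> rows, with \<open>m\<close> in the middle part, leaves only the
  edge between \<open>m\<close> and \<open>m + 1\<close>: the increment there equals \<open>- (3 - l)\<close> times the \<open>m\<close>-th partial sum, and
  proper partial sums of a nonzero nondecreasing sequence with zero sum are negative. At the two ends
  the twin rows give the same conclusion directly.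
\<close>

lemma ladder_eigenvector_strict_mono:
  fixes a :: "nat \<Rightarrow> real"
  assumes n: "n \<ge> 6" and l: "2 < l" "l < 3"
    and mono: "\<And>k. 1 \<le> k \<Longrightarrow> k < n \<Longrightarrow> a k \<le> a (Suc k)"
    and sum0: "(\<Sum>i=1..n. a i) = 0" and nz: "i \<in> {1..n}" "a i \<noteq> 0"
    and eig: "\<And>i. i \<in> {1..n} \<Longrightarrow> (\<Sum>j | (i, j) \<in> ladder n. a j) = l * a i"
    and k: "2 \<le> k" "k \<le> n - 2"
  shows "a k < a (Suc k)"
proof -
  have pts: "1 \<in> {1..n}" "2 \<in> {1..n}" "3 \<in> {1..n}" "n - 2 \<in> {1..n}" "n - 1 \<in> {1..n}" "n \<in> {1..n}"
    using n by auto
  have neg: "(\<Sum>i=1..k. a i) < 0" if "1 \<le> k" "k < n" for k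
    by (rule partial_sum_neg[OF mono sum0 nz that])
  have pos: "(3 - l) * c < 0" if "c < 0" for c using that l by (simp add: mult_pos_neg)
  have r1: "a 1 + a 2 + a 3 = l * a 1" using eig[OF pts(1)] unfolding sum_ladder_row[OF n] .
  have r2: "a 1 + a 2 + a 3 = l * a 2" using eig[OF pts(2)] unfolding sum_ladder_row[OF n] .
  have r3: "a 1 + a 2 + a 4 = l * a 3" using eig[OF pts(3)] unfolding sum_ladder_row[OF n] .
  have r4: "a (n - 2) + a (n - 1) + a n = l * a (n - 1)" using eig[OF pts(5)] unfolding sum_ladder_row[OF n] .
  have r5: "a (n - 2) + a (n - 1) + a n = l * a n" using eig[OF pts(6)] unfolding sum_ladder_row[OF n] .
  have flux: "a (Suc m) - a m = - (3 - l) * (\<Sum>i=1..m. a i)" if "3 \<le> m" "m \<le> n - 3" for m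
    using that
  proof (induction m rule: dec_induct)
    case base
    have "(\<Sum>i=1..3. a i) = a 1 + a 2 + a 3" by (simp add: numeral_3_eq_3 numeral_2_eq_2)
    moreover have "l * (a 1 + a 2 + a 3) = l * a 1 + l * a 2 + l * a 3" by (simp add: algebra_simps)
    moreover have "- (3 - l) * (a 1 + a 2 + a 3) = l * (a 1 + a 2 + a 3) - 3 * (a 1 + a 2 + a 3)"
      by (simp add: algebra_simps)
    moreover have "Suc 3 = 4" by simp
    ultimately show ?case using r1 r2 r3 by (simp only:)
  next
    case (step m)
    have row: "a m + a (Suc m) + a (Suc (Suc m)) = l * a (Suc m)"
      using eig[of "Suc m"] sum_ladder_row(4)[OF n, of "Suc m" a] step n by auto
    have "a (Suc m) - a m = - (3 - l) * (\<Sum>i=1..m. a i)" using step by simp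
    then show ?case using row by (simp add: algebra_simps)
  qed
  consider "k = 2" | "3 \<le> k" "k \<le> n - 3" | "k = n - 2" using k by linarith
  then show ?thesis
  proof cases
    case 1
    have "a 1 = a 2" using r1 r2 l by simp
    moreover have "a 1 < 0" using neg[of 1] n by simp
    moreover have "a 3 - a 2 = - ((3 - l) * a 1)" using r1 calculation(1) by (simp add: algebra_simps)
    ultimately have "a 2 < a 3" using pos[of "a 1"] by linarith
    then show ?thesis using 1 by simp
  next
    case 2
    have "(3 - l) * (\<Sum>i=1..k. a i) < 0" by (rule pos[OF neg]) (use k n in linarith)+
    moreover have "a (Suc k) - a k = - ((3 - l) * (\<Sum>i=1..k. a i))"
      using flux[OF 2] by (simp only: minus_mult_left)
    ultimately show ?thesis by linarith
  next
    case 3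
    have eq: "a (n - 1) = a n" using r4 r5 l by simp
    have "(\<Sum>i=1..n. a i) = (\<Sum>i=1..n - 1. a i) + a n"
    proof -
      have "{1..n} = insert n {1..n - 1}" using n by auto
      then show ?thesis using n by simp
    qed
    moreover have "(\<Sum>i=1..n - 1. a i) < 0" by (rule neg) (use n in linarith)+
    ultimately have "a n > 0" using sum0 by linarith
    moreover have "a (n - 1) - a (n - 2) = - ((3 - l) * - a n)" using r5 eq by (simp add: algebra_simps)
    ultimately have "a (n - 2) < a (n - 1)" using pos[of "- a n"] by linarith
    then show ?thesis using 3 n by (simp add: Suc_diff_Suc numeral_2_eq_2)
  qed
qed

text \<open>
  A step function with zero sum whose only jump is between \<open>3\<close> and \<open>4\<close>, where a single element of the
  ladder crosses in each direction. Only the corner \<open>(3, 3)\<close> enters its bilinear form, and the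
  Rayleigh quotient already exceeds \<open>2\<close>.
\<close>

lemma ladder_test_vector:
  assumes n: "n \<ge> 6"
  defines "f \<equiv> \<lambda>i. if i \<le> 3 then 3 - real n else 3"
  shows "(\<Sum>i=1..n. f i) = 0"
    and "(\<Sum>(i, j)\<in>ladder n. f i * f j) > 2 * (\<Sum>i=1..n. (f i)\<^sup>2)"
proof -
  interpret L: cubic_pattern n "ladder n" using n by (rule ladder_cubic_pattern)
  have sums: "(\<Sum>i=1..n. h (f i)) = 3 * h (3 - real n) + (real n - 3) * h 3" for h :: "real \<Rightarrow> real"
  proof -
    have "(\<Sum>i=1..n. h (f i)) = (\<Sum>i\<in>{1..3}. h (f i)) + (\<Sum>i\<in>{4..n}. h (f i))"
      using n by (subst sum.union_disjoint [symmetric]) (auto intro: sum.cong)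
    also have "(\<Sum>i\<in>{1..3}. h (f i)) = (\<Sum>i\<in>{1..3::nat}. h (3 - real n))"
      by (intro sum.cong) (auto simp: f_def)
    also have "(\<Sum>i\<in>{4..n}. h (f i)) = (\<Sum>i\<in>{4..n}. h 3)"
      by (intro sum.cong) (auto simp: f_def)
    finally show ?thesis using n by (simp add: of_nat_diff)
  qed
  show s0: "(\<Sum>i=1..n. f i) = 0" using sums[of "\<lambda>t. t"] by (simp add: algebra_simps)
  have "{(i, j) \<in> ladder n. i \<le> 3 \<and> 3 < j} = {(3, 4)}" using n by (auto simp: ladder_def)
  then have c: "corner (ladder n) 3 3 = 8" using L.corner_plus_overhang[of 3 3] n by (simp add: overhang_def)
  have "(\<Sum>k=1..<n. \<Sum>l=1..<n. (f (Suc k) - f k) * (f (Suc l) - f l) * real (corner (ladder n) k l)) =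
    (\<Sum>k=1..<n. if k = 3 then (\<Sum>l=1..<n. if l = 3 then real n * real n * real (corner (ladder n) k l) else 0) else 0)"
  proof (intro sum.cong refl)
    have df: "f (Suc k) - f k = (if k = 3 then real n else 0)" for k by (simp add: f_def)
    show "(\<Sum>l=1..<n. (f (Suc k) - f k) * (f (Suc l) - f l) * real (corner (ladder n) k l)) =
      (if k = 3 then (\<Sum>l=1..<n. if l = 3 then real n * real n * real (corner (ladder n) k l) else 0) else 0)" for k
    proof (cases "k = 3")
      case True
      have "(f (Suc k) - f k) * (f (Suc l) - f l) * t = (if l = 3 then real n * real n * t else 0)" for l t
        unfolding df using True by simp
      then show ?thesis using True by (simp only: refl if_True)
    qed (simp add: df)
  qed
  also have "\<dots> = 8 * (real n)\<^sup>2" using n by (simp add: c power2_eq_square)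
  finally have "(\<Sum>(i, j)\<in>ladder n. f i * f j) = 8 * (real n)\<^sup>2 - 27 * real n"
    using L.bilinear_eq_corners[of f f] s0 n by (simp add: f_def)
  moreover have "(\<Sum>i=1..n. (f i)\<^sup>2) = 3 * (real n)\<^sup>2 - 9 * real n"
    using sums[of "\<lambda>t. t\<^sup>2"] by (simp add: power2_eq_square algebra_simps)
  moreover have "2 * (real n)\<^sup>2 > 9 * real n"
    using n by (simp add: power2_eq_square)
  ultimately show "(\<Sum>(i, j)\<in>ladder n. f i * f j) > 2 * (\<Sum>i=1..n. (f i)\<^sup>2)" by simp
qed

section \<open>Bipartite graphs with sorted colour classes\<close>

lemma ex_sorted_enumeration:
  fixes x :: "'v \<Rightarrow> real"
  assumes "finite X"
  obtains p where "bij_betw p {1..card X} X"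
    "\<And>k. 1 \<le> k \<Longrightarrow> k < card X \<Longrightarrow> x (p k) \<le> x (p (Suc k))"
proof -
  obtain xs0 where xs0: "distinct xs0" "set xs0 = X" using finite_distinct_list assms by blast
  define xs where "xs = sort_key x xs0"
  have xs: "distinct xs" "set xs = X" "sorted (map x xs)" using xs0 by (auto simp: xs_def)
  have len: "length xs = card X" using xs by (metis distinct_card)
  have "bij_betw ((!) xs \<circ> (\<lambda>k. k - 1)) {1..card X} X"
  proof (rule bij_betw_trans)
    show "bij_betw (\<lambda>k. k - 1) {1..card X} {..<card X}"
      by (rule bij_betw_byWitness[where f' = Suc]) auto
    show "bij_betw ((!) xs) {..<card X} X" using xs len by (intro bij_betw_nth) auto
  qed
  moreover have "x (xs ! (k - 1)) \<le> x (xs ! (Suc k - 1))" if "1 \<le> k" "k < card X" for k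
    using sorted_nth_mono[OF xs(3), of "k - 1" k] that len by simp
  ultimately show thesis using that[of "(!) xs \<circ> (\<lambda>k. k - 1)"] by simp
qed

locale bipartite_enumeration = connected_cubic G
  for G :: "'a pair_pre_digraph" +
  fixes X Y :: "'a set" and p q :: "nat \<Rightarrow> 'a" and n :: nat
  assumes XY: "X \<union> Y = V" "X \<inter> Y = {}"
    and edges: "(v, w) \<in> parcs G \<Longrightarrow> v \<in> X \<and> w \<in> Y \<or> v \<in> Y \<and> w \<in> X"
    and p: "bij_betw p {1..n} X"
    and q: "bij_betw q {1..n} Y"
begin

definition pattern :: "(nat \<times> nat) set" where
  "pattern = {(i, j). i \<in> {1..n} \<and> j \<in> {1..n} \<and> (p i, q j) \<in> parcs G}"

lemma swap: "bipartite_enumeration G Y X q p n"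
  using XY edges p q by unfold_locales auto

lemma p_in: "i \<in> {1..n} \<Longrightarrow> p i \<in> X" and q_in: "j \<in> {1..n} \<Longrightarrow> q j \<in> Y"
  using p q by (auto simp: bij_betw_def)

lemma finite_XY: "finite X" "finite Y"
  using finite_V XY by (auto intro: finite_subset)

lemma neighbours_bij:
  assumes "i \<in> {1..n}"
  shows "bij_betw q {j. (i, j) \<in> pattern} {w. (p i, w) \<in> parcs G}"
proof (rule bij_betw_subset[OF q])
  show "{j. (i, j) \<in> pattern} \<subseteq> {1..n}" by (auto simp: pattern_def)
  have "w \<in> q ` {j. (i, j) \<in> pattern}" if "(p i, w) \<in> parcs G" for w
  proof -
    have "w \<in> Y" using edges[OF that] p_in[OF assms] XY by auto
    then obtain j where "j \<in> {1..n}" "w = q j" using q by (auto simp: bij_betw_def)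
    then show ?thesis using that assms by (auto simp: pattern_def)
  qed
  then show "q ` {j. (i, j) \<in> pattern} = {w. (p i, w) \<in> parcs G}"
    by (auto simp: pattern_def)
qed

lemma sum_adj_row:
  assumes "i \<in> {1..n}"
  shows "(\<Sum>w\<in>V. adj G (p i) w * h w) = (\<Sum>j | (i, j) \<in> pattern. h (q j))"
  unfolding sum_adj using sum.reindex_bij_betw[OF neighbours_bij[OF assms], of h] by simp

lemma sum_V: "(\<Sum>v\<in>V. h v) = (\<Sum>i=1..n. h (p i)) + (\<Sum>j=1..n. h (q j) :: real)"
proof -
  have "(\<Sum>v\<in>V. h v) = (\<Sum>v\<in>X. h v) + (\<Sum>v\<in>Y. h v)"
    unfolding XY(1) [symmetric] by (rule sum.union_disjoint) (use finite_XY XY in auto)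
  then show ?thesis
    using sum.reindex_bij_betw[OF p, of h] sum.reindex_bij_betw[OF q, of h] by simp
qed

lemma row: "i \<in> {1..n} \<Longrightarrow> card {j. (i, j) \<in> pattern} = 3"
  using bij_betw_same_card[OF neighbours_bij, of i] card_neighbours[of "p i"] p_in[of i] XY by auto

end

lemma (in bipartite_enumeration) swap_pattern:
  "bipartite_enumeration.pattern G q p n = pattern\<inverse>"
proof -
  interpret S: bipartite_enumeration G Y X q p n by (rule swap)
  show ?thesis using arcs_symmetric by (auto simp: S.pattern_def pattern_def)
qed

context bipartite_enumeration
begin

lemma col:
  assumes "j \<in> {1..n}"
  shows "card {i. (i, j) \<in> pattern} = 3"
proof -
  interpret S: bipartite_enumeration G Y X q p n by (rule swap)
  show ?thesis using S.row[OF assms] by (simp add: swap_pattern)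
qed

lemma sum_adj_col:
  assumes "j \<in> {1..n}"
  shows "(\<Sum>w\<in>V. adj G (q j) w * h w) = (\<Sum>i | (i, j) \<in> pattern. h (p i))"
proof -
  interpret S: bipartite_enumeration G Y X q p n by (rule swap)
  show ?thesis using S.sum_adj_row[OF assms] by (simp add: swap_pattern)
qed

text \<open>
  Otherwise membership in the set of the first \<open>k\<close> vertices of both classes is constant along edges,
  hence constant.
\<close>

lemma cut:
  assumes "1 \<le> k" "k < n"
  shows "\<exists>(i, j) \<in> pattern. (i \<le> k \<and> k < j) \<or> (j \<le> k \<and> k < i)"
proof (rule ccontr)
  assume no: "\<not> ?thesis"
  define W where "W = p ` {1..k} \<union> q ` {1..k}"
  have pW: "p i \<in> W \<longleftrightarrow> i \<le> k" if "i \<in> {1..n}" for i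
  proof -
    have "p i \<notin> q ` {1..k}" using p_in[OF that] q_in XY assms by fastforce
    moreover have "p i \<in> p ` {1..k} \<longleftrightarrow> i \<in> {1..k}"
      by (rule inj_on_image_mem_iff[of p "{1..n}"]) (use p that assms in \<open>auto simp: bij_betw_def\<close>)
    ultimately show ?thesis using that by (auto simp: W_def)
  qed
  have qW: "q i \<in> W \<longleftrightarrow> i \<le> k" if "i \<in> {1..n}" for i
  proof -
    have "q i \<notin> p ` {1..k}" using q_in[OF that] p_in XY assms by fastforce
    moreover have "q i \<in> q ` {1..k} \<longleftrightarrow> i \<in> {1..k}"
      by (rule inj_on_image_mem_iff[of q "{1..n}"]) (use q that assms in \<open>auto simp: bij_betw_def\<close>)
    ultimately show ?thesis using that by (auto simp: W_def)
  qed
  have XW: "(v \<in> W) = (w \<in> W)" if "(v, w) \<in> parcs G" "v \<in> X" "w \<in> Y" for v w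
  proof -
    have "v \<in> p ` {1..n}" "w \<in> q ` {1..n}" using that p q by (simp_all add: bij_betw_def)
    then obtain i j where ij: "i \<in> {1..n}" "v = p i" "j \<in> {1..n}" "w = q j" by blast
    then have "(i, j) \<in> pattern" using that by (auto simp: pattern_def)
    then have "i \<le> k \<longleftrightarrow> j \<le> k" using no by (metis (mono_tags, lifting) case_prodI not_le)
    then show ?thesis using ij pW qW by simp
  qed
  have "(v \<in> W) = (w \<in> W)" if "(v, w) \<in> parcs G" for v w
    using edges[OF that] XW[of v w] XW[of w v] that arcs_symmetric[OF that] by blast
  moreover have "p 1 \<in> V" "p n \<in> V" using p_in[of 1] p_in[of n] assms XY by auto
  ultimately have "(p 1 \<in> W) = (p n \<in> W)" by (rule connected_constant[OF conn])
  then show False using pW[of 1] pW[of n] assms by auto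
qed

sublocale pat: cubic_pattern n pattern
proof
  show "pattern \<subseteq> {1..n} \<times> {1..n}" by (auto simp: pattern_def)
qed (fact row col cut)+

lemma quad_form_pattern:
  "quad_form V (adj G) x = 2 * (\<Sum>(i, j)\<in>pattern. x (p i) * x (q j))"
proof -
  have fin: "finite {j. (i, j) \<in> pattern}" "finite {i. (i, j) \<in> pattern}" for i j
    by (rule finite_subset[of _ "{1..n}"]; use pat.sub in auto)+
  have Sig: "(\<Sum>i=1..n. \<Sum>j | (i, j) \<in> pattern. g i j) = (\<Sum>(i, j)\<in>pattern. g i j)" for g :: "nat \<Rightarrow> nat \<Rightarrow> real"
  proof -
    have "pattern = Sigma {1..n} (\<lambda>i. {j. (i, j) \<in> pattern})" using pat.sub by auto
    moreover have "(\<Sum>i=1..n. \<Sum>j | (i, j) \<in> pattern. g i j) =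
        (\<Sum>(i, j)\<in>Sigma {1..n} (\<lambda>i. {j. (i, j) \<in> pattern}). g i j)"
      by (rule sum.Sigma) (use fin in auto)
    ultimately show ?thesis by simp
  qed
  have swap_sum: "(\<Sum>j=1..n. \<Sum>i | (i, j) \<in> pattern. g i j) = (\<Sum>i=1..n. \<Sum>j | (i, j) \<in> pattern. g i j)"
    for g :: "nat \<Rightarrow> nat \<Rightarrow> real"
  proof -
    have "{i. (i, j) \<in> pattern} = {i \<in> {1..n}. (i, j) \<in> pattern}" for j using pat.sub by auto
    moreover have "{j. (i, j) \<in> pattern} = {j \<in> {1..n}. (i, j) \<in> pattern}" for i using pat.sub by auto
    ultimately show ?thesis
      using sum.swap_restrict[of "{1..n}" "{1..n}" g "\<lambda>i j. (i, j) \<in> pattern"] by simp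
  qed
  have "quad_form V (adj G) x = (\<Sum>v\<in>V. x v * (\<Sum>w\<in>V. adj G v w * x w))"
    unfolding quad_form_def by (simp add: sum_distrib_left mult_ac)
  also have "\<dots> = (\<Sum>i=1..n. x (p i) * (\<Sum>j | (i, j) \<in> pattern. x (q j))) +
      (\<Sum>j=1..n. x (q j) * (\<Sum>i | (i, j) \<in> pattern. x (p i)))"
    unfolding sum_V[of "\<lambda>v. x v * (\<Sum>w\<in>V. adj G v w * x w)"]
    by (intro arg_cong2[where f = "(+)"] sum.cong refl) (simp_all only: sum_adj_row sum_adj_col)
  also have "(\<Sum>j=1..n. x (q j) * (\<Sum>i | (i, j) \<in> pattern. x (p i))) =
      (\<Sum>j=1..n. \<Sum>i | (i, j) \<in> pattern. x (p i) * x (q j))"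
    by (simp add: sum_distrib_left mult_ac)
  also have "(\<Sum>i=1..n. x (p i) * (\<Sum>j | (i, j) \<in> pattern. x (q j))) =
      (\<Sum>i=1..n. \<Sum>j | (i, j) \<in> pattern. x (p i) * x (q j))"
    by (simp add: sum_distrib_left)
  finally show ?thesis unfolding swap_sum Sig by simp
qed

end

text \<open>
  The two classes have equal size: each neighbour sum of the indicator function of \<open>X\<close> is \<open>0\<close> on \<open>X\<close> and \<open>3\<close>
  on \<open>Y\<close>, and the neighbour sums add up to \<open>3\<close> times the size of \<open>X\<close>.
\<close>

lemma ex_bipartite_enumeration:
  fixes x :: "'a \<Rightarrow> real"
  assumes "G \<in> connected_cubic_bipartite_graphs (2 * n)"
  obtains X Y p q where "bipartite_enumeration G X Y p q n"
    "\<And>k. 1 \<le> k \<Longrightarrow> k < n \<Longrightarrow> x (p k) \<le> x (p (Suc k))"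
    "\<And>k. 1 \<le> k \<Longrightarrow> k < n \<Longrightarrow> x (q k) \<le> x (q (Suc k))"
proof -
  interpret connected_cubic G
    by (rule connected_cubic.intro) (use assms in \<open>simp_all add: connected_cubic_bipartite_graphs_def\<close>)
  have "bipartite G" using assms by (simp add: connected_cubic_bipartite_graphs_def)
  then obtain X Y where part: "X \<union> Y = V \<and> X \<inter> Y = {} \<and>
      (\<forall>(a, b) \<in> parcs G. (a \<in> X \<and> b \<in> Y) \<or> (a \<in> Y \<and> b \<in> X))"
    unfolding bipartite_def by (elim exE) (rule that)
  note XY = conjunct1[OF part] conjunct1[OF conjunct2[OF part]]
    and arcs = conjunct2[OF conjunct2[OF part]]
  have edges: "v \<in> X \<and> w \<in> Y \<or> v \<in> Y \<and> w \<in> X" if "(v, w) \<in> parcs G" for v w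
    using bspec[OF arcs that] by simp
  have fin: "finite X" "finite Y" using finite_V XY by (auto intro: finite_subset)
  have "real (card X) = real (card Y)"
  proof -
    have split: "(\<Sum>v\<in>V. h v) = (\<Sum>v\<in>X. h v) + (\<Sum>v\<in>Y. h v)" for h :: "'a \<Rightarrow> real"
      unfolding XY(1) [symmetric] by (rule sum.union_disjoint) (use fin XY in auto)
    define z :: "'a \<Rightarrow> real" where "z v = (if v \<in> X then 1 else 0)" for v
    have "(\<Sum>w\<in>V. adj G v w * z w) = 3 - 3 * z v" if "v \<in> V" for v
    proof -
      have "(\<Sum>w\<in>V. adj G v w * z w) = (\<Sum>w\<in>V. adj G v w * (1 - z v))"
      proof (intro sum.cong refl)
        fix w assume "w \<in> V"
        have "z w = 1 - z v" if "(v, w) \<in> parcs G"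
          using edges[OF that] XY(2) by (auto simp: z_def)
        then show "adj G v w * z w = adj G v w * (1 - z v)" by (simp add: adj_def)
      qed
      then show ?thesis using row_sum_adj[OF that] by (simp add: sum_distrib_right [symmetric])
    qed
    then have "(\<Sum>v\<in>V. 3 - 3 * z v) = 3 * (\<Sum>v\<in>V. z v)"
      using sum_kernel_image[of V "adj G" 3 z] adj_sym row_sum_adj by simp
    moreover have "(\<Sum>v\<in>X. z v) = real (card X)" by (simp add: z_def)
    moreover have "(\<Sum>v\<in>Y. z v) = 0" using XY(2) by (auto simp: z_def intro!: sum.neutral)
    moreover have "card V = card X + card Y" using card_Un_disjoint[OF fin XY(2)] XY(1) by simp
    ultimately show ?thesis
      by (simp add: split sum_subtractf sum_distrib_left [symmetric])
  qed
  moreover have "card X + card Y = 2 * n"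
    using assms card_Un_disjoint[OF fin XY(2)] XY(1) by (simp add: connected_cubic_bipartite_graphs_def)
  ultimately have card: "card X = n" "card Y = n" by linarith+
  obtain p where p: "bij_betw p {1..card X} X" "\<And>k. 1 \<le> k \<Longrightarrow> k < card X \<Longrightarrow> x (p k) \<le> x (p (Suc k))"
    using ex_sorted_enumeration[OF fin(1), of x] by blast
  obtain q where q: "bij_betw q {1..card Y} Y" "\<And>k. 1 \<le> k \<Longrightarrow> k < card Y \<Longrightarrow> x (q k) \<le> x (q (Suc k))"
    using ex_sorted_enumeration[OF fin(2), of x] by blast
  have "bipartite_enumeration G X Y p q n"
    using XY edges p(1) q(1) by unfold_locales (auto simp: card)
  then show thesis using that p(2) q(2) by (simp add: card)
qed

section \<open>Isomorphic graphs\<close>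

lemma digraph_iso_withI:
  fixes G :: "'a pair_pre_digraph" and H :: "'b pair_pre_digraph"
  assumes G: "pair_graph G" and H: "pair_graph H"
    and f: "bij_betw f (pverts H) (pverts G)"
    and arcs: "\<And>v w. v \<in> pverts H \<Longrightarrow> w \<in> pverts H \<Longrightarrow> (f v, f w) \<in> parcs G \<longleftrightarrow> (v, w) \<in> parcs H"
  shows "digraph_iso (with_proj G) (with_proj H)"
proof -
  interpret G: pair_graph G by (rule G)
  interpret H: pair_graph H by (rule H)
  define h where "h = inv_into (pverts H) f"
  have h: "bij_betw h (pverts G) (pverts H)" unfolding h_def by (rule bij_betw_inv_into[OF f])
  have fh: "f (h v) = v" if "v \<in> pverts G" for v
    unfolding h_def using f that by (metis bij_betw_inv_into_right)
  have hf: "h (f v) = v" if "v \<in> pverts H" for v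
    unfolding h_def using f that by (metis bij_betw_inv_into_left)
  have hV: "h v \<in> pverts H" if "v \<in> pverts G" for v using h that by (auto simp: bij_betw_def)
  have fV: "f v \<in> pverts G" if "v \<in> pverts H" for v using f that by (auto simp: bij_betw_def)
  let ?hom = "\<lparr>iso_verts = h, iso_arcs = map_prod h h, iso_head = snd, iso_tail = fst\<rparr>"
  have inj: "inj_on h (pverts G)" using h by (auto simp: bij_betw_def)
  have "inj_on (map_prod h h) (parcs G)"
    by (rule inj_on_subset[OF map_prod_inj_on[OF inj inj]]) (auto dest: G.in_arcsD1 G.in_arcsD2)
  moreover have "wf_digraph (with_proj G)" by (rule G.wf_digraph_axioms)
  ultimately have "pre_digraph.digraph_isomorphism (with_proj G) ?hom"
    using inj by (simp add: pre_digraph.digraph_isomorphism_def)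
  moreover have "with_proj H = app_iso ?hom (with_proj G)"
  proof -
    have "h ` pverts G = pverts H" using h by (auto simp: bij_betw_def)
    moreover have "map_prod h h ` parcs G = parcs H"
    proof
      show "map_prod h h ` parcs G \<subseteq> parcs H"
      proof
        fix e assume "e \<in> map_prod h h ` parcs G"
        then obtain v w where vw: "(v, w) \<in> parcs G" "e = (h v, h w)" by auto
        then have "v \<in> pverts G" "w \<in> pverts G" by (auto dest: G.in_arcsD1 G.in_arcsD2)
        then show "e \<in> parcs H" using vw arcs[of "h v" "h w"] fh hV by simp
      qed
      show "parcs H \<subseteq> map_prod h h ` parcs G"
      proof
        fix e assume e: "e \<in> parcs H"
        obtain v w where vw: "e = (v, w)" by (cases e)
        then have V: "v \<in> pverts H" "w \<in> pverts H" using e by (auto dest: H.in_arcsD1 H.in_arcsD2)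
        then have "(f v, f w) \<in> parcs G" using arcs e vw by simp
        then show "e \<in> map_prod h h ` parcs G"
          using vw hf V by (intro image_eqI[of _ _ "(f v, f w)"]) auto
      qed
    qed
    ultimately show ?thesis by (simp add: app_iso_def with_proj_def)
  qed
  ultimately show ?thesis unfolding digraph_iso_def by blast
qed

text \<open>
  Listing the vertices of \<open>H\<close> in the order of their preimages gives the very same adjacency matrix.
\<close>

lemma digraph_iso_spectral_gap:
  fixes G :: "'a pair_pre_digraph" and H :: "'b pair_pre_digraph"
  assumes G: "pair_graph G" and iso: "digraph_iso (with_proj G) (with_proj H)"
  shows "spectral_gap G = spectral_gap H"
proof -
  interpret G: pair_graph G by (rule G)
  obtain hom where hom: "pre_digraph.digraph_isomorphism (with_proj G) hom"
    and H: "with_proj H = app_iso hom (with_proj G)"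
    using iso unfolding digraph_iso_def by blast
  define h where "h = iso_verts hom"
  have inj: "inj_on h (pverts G)"
    using hom by (simp add: pre_digraph.digraph_isomorphism_def h_def)
  have V: "pverts H = h ` pverts G"
    using arg_cong[OF H, of verts] by (simp add: h_def)
  have tails: "fst = iso_tail hom" "snd = iso_head hom"
    using arg_cong[OF H, of tail] arg_cong[OF H, of head] by simp_all
  have arc: "iso_arcs hom (v, w) = (h v, h w)" if "(v, w) \<in> parcs G" for v w
  proof -
    have "h v = fst (iso_arcs hom (v, w)) \<and> h w = snd (iso_arcs hom (v, w))"
      unfolding tails h_def using hom that by (auto simp: pre_digraph.digraph_isomorphism_def)
    then show ?thesis by (simp add: prod_eq_iff)
  qed
  have E: "parcs H = iso_arcs hom ` parcs G"
    using arg_cong[OF H, of arcs] by simp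
  have arcs: "(h v, h w) \<in> parcs H \<longleftrightarrow> (v, w) \<in> parcs G" if vw: "v \<in> pverts G" "w \<in> pverts G" for v w
  proof
    assume "(v, w) \<in> parcs G"
    then show "(h v, h w) \<in> parcs H" unfolding E using arc by force
  next
    assume "(h v, h w) \<in> parcs H"
    then obtain v' w' where e: "(v', w') \<in> parcs G" "(h v, h w) = (h v', h w')"
      unfolding E using arc by fastforce
    then have "v' \<in> pverts G" "w' \<in> pverts G" by (auto dest: G.in_arcsD1 G.in_arcsD2)
    then have "v = v'" "w = w'" using e(2) inj vw by (auto dest: inj_onD)
    then show "(v, w) \<in> parcs G" using e(1) by simp
  qed
  obtain vs where vs: "distinct vs" "set vs = pverts G"
    using finite_distinct_list G.pair_finite_verts by blast
  have "adjacency_matrix G vs = adjacency_matrix H (map h vs)"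
  proof (rule eq_matI)
    fix i j assume "i < dim_row (adjacency_matrix H (map h vs))" "j < dim_col (adjacency_matrix H (map h vs))"
    then have ij: "i < length vs" "j < length vs" by (auto simp: adjacency_matrix_def)
    then have "vs ! i \<in> pverts G" "vs ! j \<in> pverts G" using nth_mem vs(2) by blast+
    then show "adjacency_matrix G vs $$ (i, j) = adjacency_matrix H (map h vs) $$ (i, j)"
      using ij arcs by (simp add: adjacency_matrix_def)
  qed (simp_all add: adjacency_matrix_def)
  moreover have "distinct (map h vs)" "set (map h vs) = pverts H"
    using vs inj V by (auto simp: distinct_map)
  ultimately have "graph_eigenvalues G = graph_eigenvalues H"
    using graph_eigenvalues_eq[OF vs] graph_eigenvalues_eq[of "map h vs" H] by simp
  then show ?thesis by (simp add: spectral_gap_def)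
qed

section \<open>The graph \<open>H_graph n\<close>\<close>

lemma H_arc_iff:
  assumes n: "n \<ge> 6"
  shows "(Inl i, Inr j) \<in> parcs (H_graph n) \<longleftrightarrow> (i, j) \<in> ladder n"
    and "(Inr j, Inl i) \<in> parcs (H_graph n) \<longleftrightarrow> (i, j) \<in> ladder n"
    and "(Inl i, Inl i') \<notin> parcs (H_graph n)"
    and "(Inr j, Inr j') \<notin> parcs (H_graph n)"
proof -
  have "(i \<in> {1, 2, 3} \<and> j \<in> {1, 2, 3} \<and> (i, j) \<noteq> (3, 3) \<or> j = i + 1 \<and> 3 \<le> i \<and> i \<le> n - 3 \<or>
      i = j + 1 \<and> 3 \<le> j \<and> j \<le> n - 3 \<or> i = j \<and> 4 \<le> i \<and> i \<le> n - 3 \<or>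
      i \<in> {n - 2, n - 1, n} \<and> j \<in> {n - 2, n - 1, n} \<and> (i, j) \<noteq> (n - 2, n - 2)) \<longleftrightarrow> (i, j) \<in> ladder n"
    (is "?L \<longleftrightarrow> _")
  proof (cases "i \<in> {1..n}")
    case True
    have row: "(i, j) \<in> ladder n \<longleftrightarrow> j \<in> J" if "{j. (i, j) \<in> ladder n} = J" for J using that by blast
    show ?thesis using n True
    proof (cases rule: ladder_index_cases)
      case 1
      have "?L \<longleftrightarrow> j \<in> {1, 2, 3}" using 1 n by auto
      then show ?thesis using row[of "{1, 2, 3}"] ladder_row(1)[OF n] 1 by simp
    next
      case 2
      have "?L \<longleftrightarrow> j \<in> {1, 2, 3}" using 2 n by auto
      then show ?thesis using row[of "{1, 2, 3}"] ladder_row(2)[OF n] 2 by simp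
    next
      case 3
      have "?L \<longleftrightarrow> j \<in> {1, 2, 4}" using 3 n by auto
      then show ?thesis using row[of "{1, 2, 4}"] ladder_row(3)[OF n] 3 by simp
    next
      case 4
      have "i \<notin> {1, 2, 3}" "i \<notin> {n - 2, n - 1, n}" using 4 n by auto
      then have "?L \<longleftrightarrow> j = i + 1 \<or> i = j + 1 \<or> i = j" using 4 by auto
      also have "\<dots> \<longleftrightarrow> j \<in> {i - 1, i, Suc i}" using 4 by auto
      finally show ?thesis using row[of "{i - 1, i, Suc i}"] ladder_row(4)[OF n 4] by simp
    next
      case 5
      have i: "i \<notin> {1, 2, 3}" "i \<in> {n - 2, n - 1, n}" "\<not> i \<le> n - 3" "i = j + 1 \<longleftrightarrow> j = n - 3"
        using 5 n by auto
      have "(i, j) \<noteq> (n - 2, n - 2) \<longleftrightarrow> j \<noteq> n - 2" using 5 by simp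
      moreover have "j = n - 3 \<Longrightarrow> 3 \<le> j \<and> j \<le> n - 3" "j = n - 1 \<Longrightarrow> j \<noteq> n - 2" "j = n \<Longrightarrow> j \<noteq> n - 2"
        using n by linarith+
      ultimately have "?L \<longleftrightarrow> j = n - 3 \<or> j = n - 1 \<or> j = n" using i by blast
      then show ?thesis using row[of "{n - 3, n - 1, n}"] ladder_row(5)[OF n] 5 by simp
    next
      case 6
      have i: "i \<notin> {1, 2, 3}" "i \<in> {n - 2, n - 1, n}" "\<not> i \<le> n - 3" "i = j + 1 \<Longrightarrow> \<not> j \<le> n - 3" "i \<noteq> n - 2"
        using 6 n by auto
      have "(i, j) \<noteq> (n - 2, n - 2)" using i(5) by simp
      then have "?L \<longleftrightarrow> j = n - 2 \<or> j = n - 1 \<or> j = n" using i by blast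
      then show ?thesis using row[of "{n - 2, n - 1, n}"] ladder_row(6)[OF n] 6 by simp
    next
      case 7
      have i: "i \<notin> {1, 2, 3}" "i \<in> {n - 2, n - 1, n}" "\<not> i \<le> n - 3" "i = j + 1 \<Longrightarrow> \<not> j \<le> n - 3" "i \<noteq> n - 2"
        using 7 n by auto
      have "(i, j) \<noteq> (n - 2, n - 2)" using i(5) by simp
      then have "?L \<longleftrightarrow> j = n - 2 \<or> j = n - 1 \<or> j = n" using i by blast
      then show ?thesis using row[of "{n - 2, n - 1, n}"] ladder_row(7)[OF n] 7 by simp
    qed
  next
    case False
    then have "i < 1 \<or> n < i" by auto
    then have "\<not> ?L" using n by auto
    moreover have "(i, j) \<notin> ladder n" using False by (simp add: ladder_def del: atLeastAtMost_iff)
    ultimately show ?thesis by blast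
  qed
  moreover have "(Inl i, Inr j) \<in> H_edges n \<or> (Inr j, Inl i) \<in> H_edges n \<longleftrightarrow>
     (i \<in> {1, 2, 3} \<and> j \<in> {1, 2, 3} \<and> (i, j) \<noteq> (3, 3) \<or> j = i + 1 \<and> 3 \<le> i \<and> i \<le> n - 3 \<or>
      i = j + 1 \<and> 3 \<le> j \<and> j \<le> n - 3 \<or> i = j \<and> 4 \<le> i \<and> i \<le> n - 3 \<or>
      i \<in> {n - 2, n - 1, n} \<and> j \<in> {n - 2, n - 1, n} \<and> (i, j) \<noteq> (n - 2, n - 2))"
    unfolding H_edges_def
    by (simp only: Un_iff mem_Collect_eq prod.inject sum.inject sum.distinct simp_thms
        conj_assoc ex_simps) blast
  ultimately show "(Inl i, Inr j) \<in> parcs (H_graph n) \<longleftrightarrow> (i, j) \<in> ladder n"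
    and "(Inr j, Inl i) \<in> parcs (H_graph n) \<longleftrightarrow> (i, j) \<in> ladder n"
    by (auto simp: H_graph_def)
  show "(Inl i, Inl i') \<notin> parcs (H_graph n)" "(Inr j, Inr j') \<notin> parcs (H_graph n)"
    by (auto simp: H_graph_def H_edges_def)
qed

lemma pverts_H: "pverts (H_graph n) = Inl ` {1..n} \<union> Inr ` {1..n}"
  by (simp add: H_graph_def)

lemma H_arcs_cases:
  assumes n: "n \<ge> 6" and e: "e \<in> parcs (H_graph n)"
  obtains i j where "(i, j) \<in> ladder n" "e = (Inl i, Inr j)" | i j where "(i, j) \<in> ladder n" "e = (Inr j, Inl i)"
proof -
  obtain v w where vw: "e = (v, w)" by (cases e)
  show thesis
  proof (cases v; cases w)
    fix i j assume "v = Inl i" "w = Inr j"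
    then show thesis using that(1)[of i j] e vw H_arc_iff(1)[OF n] by simp
  next
    fix i j assume "v = Inr j" "w = Inl i"
    then show thesis using that(2)[of i j] e vw H_arc_iff(2)[OF n] by simp
  qed (use e vw H_arc_iff[OF n] in auto)
qed

lemma H_in_class:
  assumes n: "n \<ge> 6"
  shows "H_graph n \<in> connected_cubic_bipartite_graphs (2 * n)"
proof -
  let ?H = "H_graph n"
  interpret L: cubic_pattern n "ladder n" using n by (rule ladder_cubic_pattern)
  note arc = H_arc_iff[OF n]
  have range: "i \<in> {1..n}" "j \<in> {1..n}" if "(i, j) \<in> ladder n" for i j using that L.sub by auto
  have sym: "sym (parcs ?H)" by (auto simp: H_graph_def intro: symI)
  have "pair_graph ?H"
  proof unfold_locales
    fix e assume e: "e \<in> parcs ?H"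
    show "fst e \<in> pverts ?H" "snd e \<in> pverts ?H" "fst e \<noteq> snd e"
      using n e by (cases rule: H_arcs_cases; use range in \<open>auto simp: pverts_H\<close>)+
  next
    show fin: "finite (pverts ?H)" by (simp add: pverts_H)
    have "parcs ?H \<subseteq> pverts ?H \<times> pverts ?H"
    proof
      fix e assume e: "e \<in> parcs ?H"
      show "e \<in> pverts ?H \<times> pverts ?H"
        using n e by (cases rule: H_arcs_cases) (use range in \<open>auto simp: pverts_H\<close>)
    qed
    then show "finite (parcs ?H)" using fin by (meson finite_SigmaI finite_subset)
    show "symmetric ?H" using sym by (simp add: symmetric_def)
  qed
  moreover have "Digraph_Component.connected (with_proj ?H)"
  proof -
    define R where "R = rtrancl_on (pverts ?H) ((parcs ?H)\<^sup>s)"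
    have symR: "sym R" unfolding R_def by (rule rtrancl_on_sym) (auto simp: symcl_def intro: symI)
    have extend: "(u, w) \<in> R" if "(u, v) \<in> R" "(v, w) \<in> parcs ?H" "w \<in> pverts ?H" for u v w
      using that unfolding R_def by (auto simp: symcl_def intro: rtrancl_on_into_rtrancl_on)
    have reach: "(Inl 1, Inl k) \<in> R \<and> (Inl 1, Inr k) \<in> R" if "1 \<le> k" "k \<le> n" for k
      using that
    proof (induction k rule: dec_induct)
      case base
      have "(Inl 1, Inl 1) \<in> R" unfolding R_def using n by (auto simp: pverts_H)
      moreover have "(Inl 1, Inr 1) \<in> parcs ?H" unfolding arc using n by (simp add: ladder_def)
      ultimately show ?case using extend[of "Inl 1" "Inl 1" "Inr 1"] n by (simp add: pverts_H)
    next
      case (step k)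
      have "(k, Suc k) \<in> ladder n" "(Suc k, k) \<in> ladder n"
        using step.hyps step.prems n by (auto simp: ladder_def)
      then have "(Inl k, Inr (Suc k)) \<in> parcs ?H" "(Inr k, Inl (Suc k)) \<in> parcs ?H"
        unfolding arc by auto
      moreover have "Inr (Suc k) \<in> pverts ?H" "Inl (Suc k) \<in> pverts ?H"
        using step.prems by (simp_all add: pverts_H)
      moreover have "(Inl 1, Inl k) \<in> R" "(Inl 1, Inr k) \<in> R" using step by simp_all
      ultimately show ?case using extend by metis
    qed
    then have reach': "(Inl 1, v) \<in> R" if "v \<in> pverts ?H" for v
      using that by (auto simp: pverts_H)
    have "(u, v) \<in> R" if "u \<in> pverts ?H" "v \<in> pverts ?H" for u v
      using reach'[OF that(1)] reach'[OF that(2)] symR rtrancl_on_trans unfolding R_def by (metis symE)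
    moreover have "pverts ?H \<noteq> {}" using n by (auto simp: pverts_H)
    ultimately show ?thesis unfolding R_def connected_conv by simp
  qed
  moreover have "cubic ?H"
  proof -
    have deg: "out_degree (with_proj ?H) v = card {w. (v, w) \<in> parcs ?H}" for v
    proof -
      have "out_arcs (with_proj ?H) v = Pair v ` {w. (v, w) \<in> parcs ?H}"
        by (auto simp: out_arcs_def)
      then show ?thesis by (simp add: out_degree_def card_image inj_on_def)
    qed
    have "card {w. (v, w) \<in> parcs ?H} = 3" if v: "v \<in> pverts ?H" for v
    proof (cases v)
      case (Inl i)
      have "w \<in> Inr ` {j. (i, j) \<in> ladder n}" if "(Inl i, w) \<in> parcs ?H" for w
        using that arc by (cases w) auto
      then have "{w. (v, w) \<in> parcs ?H} = Inr ` {j. (i, j) \<in> ladder n}" using Inl arc by auto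
      then show ?thesis using v Inl L.row[of i] by (auto simp: card_image pverts_H)
    next
      case (Inr j)
      have "w \<in> Inl ` {i. (i, j) \<in> ladder n}" if "(Inr j, w) \<in> parcs ?H" for w
        using that arc by (cases w) auto
      then have "{w. (v, w) \<in> parcs ?H} = Inl ` {i. (i, j) \<in> ladder n}" using Inr arc by auto
      then show ?thesis using v Inr L.col[of j] by (auto simp: card_image pverts_H)
    qed
    then show ?thesis by (simp add: cubic_def deg)
  qed
  moreover have "bipartite ?H"
    unfolding bipartite_def
  proof (intro exI conjI ballI)
    show "Inl ` {1..n} \<union> Inr ` {1..n} = pverts ?H" by (simp add: pverts_H)
    show "Inl ` {1..n} \<inter> Inr ` {1..n} = {}" by auto
    fix e assume e: "e \<in> parcs ?H"
    show "case e of (a, b) \<Rightarrow> a \<in> Inl ` {1..n} \<and> b \<in> Inr ` {1..n} \<or> a \<in> Inr ` {1..n} \<and> b \<in> Inl ` {1..n}"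
      using n e by (cases rule: H_arcs_cases) (use range in auto)
  qed
  moreover have "card (pverts ?H) = 2 * n"
    unfolding pverts_H by (subst card_Un_disjoint) (auto simp: card_image)
  ultimately show ?thesis by (simp add: connected_cubic_bipartite_graphs_def)
qed

lemma H_bipartite_enumeration:
  assumes n: "n \<ge> 6"
  shows "bipartite_enumeration (H_graph n) (Inl ` {1..n}) (Inr ` {1..n}) Inl Inr n"
proof -
  interpret L: cubic_pattern n "ladder n" using n by (rule ladder_cubic_pattern)
  interpret connected_cubic "H_graph n"
    by (rule connected_cubic.intro) (use H_in_class[OF n] in \<open>simp_all add: connected_cubic_bipartite_graphs_def\<close>)
  show ?thesis
  proof
    fix v w assume "(v, w) \<in> parcs (H_graph n)"
    with n show "v \<in> Inl ` {1..n} \<and> w \<in> Inr ` {1..n} \<or> v \<in> Inr ` {1..n} \<and> w \<in> Inl ` {1..n}"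
      by (cases rule: H_arcs_cases) (use L.sub in auto)
  qed (auto simp: pverts_H bij_betw_def)
qed

lemma H_pattern:
  assumes n: "n \<ge> 6"
  shows "bipartite_enumeration.pattern (H_graph n) Inl Inr n = ladder n"
proof -
  interpret bipartite_enumeration "H_graph n" "Inl ` {1..n}" "Inr ` {1..n}" Inl Inr n
    using n by (rule H_bipartite_enumeration)
  interpret L: cubic_pattern n "ladder n" using n by (rule ladder_cubic_pattern)
  show ?thesis unfolding pattern_def H_arc_iff[OF n] using L.sub by auto
qed

lemma H_eigenvalue_gt_2:
  assumes n: "n \<ge> 6"
  shows "3 - spectral_gap (H_graph n) > 2"
proof -
  interpret H: bipartite_enumeration "H_graph n" "Inl ` {1..n}" "Inr ` {1..n}" Inl Inr n
    using n by (rule H_bipartite_enumeration)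
  have card: "card H.V \<ge> 2" using H_in_class[OF n] n by (simp add: connected_cubic_bipartite_graphs_def)
  let ?l = "3 - spectral_gap (H_graph n)"
  define f :: "nat \<Rightarrow> real" where "f i = (if i \<le> 3 then 3 - real n else 3)" for i
  define y :: "nat + nat \<Rightarrow> real" where "y = case_sum f f"
  have f: "(\<Sum>i=1..n. f i) = 0" "(\<Sum>(i, j)\<in>ladder n. f i * f j) > 2 * (\<Sum>i=1..n. (f i)\<^sup>2)"
    using ladder_test_vector[OF n] unfolding f_def by simp_all
  have "(\<Sum>v\<in>H.V. y v) = 0" using H.sum_V[of y] f by (simp add: y_def)
  then have "quad_form H.V (adj (H_graph n)) y \<le> ?l * (\<Sum>v\<in>H.V. (y v)\<^sup>2)"
    using H.obtain_second_eigenvector[OF card] by metis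
  then have "2 * (\<Sum>(i, j)\<in>ladder n. f i * f j) \<le> ?l * (2 * (\<Sum>i=1..n. (f i)\<^sup>2))"
    unfolding H.quad_form_pattern H_pattern[OF n] H.sum_V by (simp add: y_def)
  then have "2 * (2 * (\<Sum>i=1..n. (f i)\<^sup>2)) < ?l * (2 * (\<Sum>i=1..n. (f i)\<^sup>2))" using f(2) by linarith
  moreover have "2 * (\<Sum>i=1..n. (f i)\<^sup>2) \<ge> 0" by (simp add: sum_nonneg)
  ultimately show ?thesis by (meson mult_right_mono not_le)
qed

section \<open>Minimality and uniqueness\<close>

theorem theorem4p2:
  fixes n :: nat
  assumes "n \<ge> 6"
  shows "H_graph n \<in> connected_cubic_bipartite_graphs (2 * n) \<and>
    (\<forall>G :: 'a pair_pre_digraph. G \<in> connected_cubic_bipartite_graphs (2 * n) \<longrightarrow>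
       spectral_gap (H_graph n) \<le> spectral_gap G \<and>
       (spectral_gap G = spectral_gap (H_graph n) \<longleftrightarrow>
          digraph_iso (with_proj G) (with_proj (H_graph n))))"
proof (intro conjI allI impI)
  note n = assms
  show H_class: "H_graph n \<in> connected_cubic_bipartite_graphs (2 * n)" using n by (rule H_in_class)
  interpret H: bipartite_enumeration "H_graph n" "Inl ` {1..n}" "Inr ` {1..n}" Inl Inr n
    using n by (rule H_bipartite_enumeration)
  interpret L: cubic_pattern n "ladder n" using n by (rule ladder_cubic_pattern)
  let ?l = "3 - spectral_gap (H_graph n)"
  have cardH: "card H.V \<ge> 2" using H_class n by (simp add: connected_cubic_bipartite_graphs_def)
  have H_bound: "quad_form H.V (adj (H_graph n)) y \<le> ?l * (\<Sum>v\<in>H.V. (y v)\<^sup>2)"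
    if "(\<Sum>v\<in>H.V. y v) = 0" for y
    using H.obtain_second_eigenvector[OF cardH] that by metis
  have l: "2 < ?l" "?l < 3"
    using H_eigenvalue_gt_2[OF n] H.obtain_second_eigenvector[OF cardH] by auto
  fix G :: "'a pair_pre_digraph"
  assume G: "G \<in> connected_cubic_bipartite_graphs (2 * n)"
  interpret G0: connected_cubic G
    by (rule connected_cubic.intro) (use G in \<open>simp_all add: connected_cubic_bipartite_graphs_def\<close>)
  have cardG: "card G0.V \<ge> 2" using G n by (simp add: connected_cubic_bipartite_graphs_def)
  obtain x where x: "(\<Sum>v\<in>G0.V. x v) = 0" "\<exists>v\<in>G0.V. x v \<noteq> 0"
    "quad_form G0.V (adj G) x = (3 - spectral_gap G) * (\<Sum>v\<in>G0.V. (x v)\<^sup>2)"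
    using G0.obtain_second_eigenvector[OF cardG] by metis
  obtain X Y p q where enum: "bipartite_enumeration G X Y p q n"
    and p: "\<And>k. 1 \<le> k \<Longrightarrow> k < n \<Longrightarrow> x (p k) \<le> x (p (Suc k))"
    and q: "\<And>k. 1 \<le> k \<Longrightarrow> k < n \<Longrightarrow> x (q k) \<le> x (q (Suc k))"
    using ex_bipartite_enumeration[OF G, of x] by blast
  interpret G: bipartite_enumeration G X Y p q n by (rule enum)
  define a where "a i = x (p i)" for i
  define b where "b i = x (q i)" for i
  have a: "\<And>k. 1 \<le> k \<Longrightarrow> k < n \<Longrightarrow> a k \<le> a (Suc k)" using p by (simp add: a_def)
  have b: "\<And>k. 1 \<le> k \<Longrightarrow> k < n \<Longrightarrow> b k \<le> b (Suc k)" using q by (simp add: b_def)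
  \<comment> \<open>the values of \<open>x\<close>, transplanted to \<open>H_graph n\<close> in increasing order on both classes\<close>
  define y :: "nat + nat \<Rightarrow> real" where "y = case_sum a b"
  define S where "S = (\<Sum>v\<in>G0.V. (x v)\<^sup>2)"
  have "S > 0"
    unfolding S_def using x(2) G0.finite_V by (metis (no_types, lifting) sum_pos2 zero_le_power2 zero_less_power2)
  have y0: "(\<Sum>v\<in>H.V. y v) = 0"
    unfolding H.sum_V using x(1) unfolding G.sum_V by (simp add: y_def a_def b_def)
  have yS: "(\<Sum>v\<in>H.V. (y v)\<^sup>2) = S"
    unfolding H.sum_V S_def G.sum_V by (simp add: y_def a_def b_def)
  have Qy: "quad_form H.V (adj (H_graph n)) y = 2 * (\<Sum>(i, j)\<in>ladder n. a i * b j)"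
    unfolding H.quad_form_pattern H_pattern[OF n] by (simp add: y_def)
  have Qx: "2 * (\<Sum>(i, j)\<in>G.pattern. a i * b j) = (3 - spectral_gap G) * S"
    using x(3) unfolding G.quad_form_pattern S_def by (simp add: a_def b_def)
  have up: "(\<Sum>(i, j)\<in>G.pattern. a i * b j) \<le> (\<Sum>(i, j)\<in>ladder n. a i * b j)"
    by (rule G.pat.bilinear_le_ladder(1)[where a = a and b = b, OF n a b])
  have Hy: "2 * (\<Sum>(i, j)\<in>ladder n. a i * b j) \<le> ?l * S"
    using H_bound[OF y0] by (simp only: Qy yS)
  have "(3 - spectral_gap G) * S \<le> ?l * S" using Qx up Hy by linarith
  then show "spectral_gap (H_graph n) \<le> spectral_gap G" using \<open>S > 0\<close> by simp
  show "spectral_gap G = spectral_gap (H_graph n) \<longleftrightarrow>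
      digraph_iso (with_proj G) (with_proj (H_graph n))"
  proof
    assume "digraph_iso (with_proj G) (with_proj (H_graph n))"
    then show "spectral_gap G = spectral_gap (H_graph n)"
      by (rule digraph_iso_spectral_gap[OF G0.graph])
  next
    assume gap: "spectral_gap G = spectral_gap (H_graph n)"
    have sums: "(\<Sum>(i, j)\<in>G.pattern. a i * b j) = (\<Sum>(i, j)\<in>ladder n. a i * b j)"
      and att: "2 * (\<Sum>(i, j)\<in>ladder n. a i * b j) = ?l * S"
      using Qx up Hy unfolding gap by linarith+
    have eig: "(\<Sum>w\<in>H.V. adj (H_graph n) v w * y w) = ?l * y v" if "v \<in> H.V" for v
      by (rule maximiser_is_eigenvector[OF H.finite_V H.adj_sym H.row_sum_adj H_bound y0 _ that])
        (simp_all only: Qy yS att)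
    have eig_a: "(\<Sum>j | (i, j) \<in> ladder n. b j) = ?l * a i" if "i \<in> {1..n}" for i
      using H.sum_adj_row[OF that, of y] eig[of "Inl i"] that unfolding H_pattern[OF n]
      by (simp add: y_def pverts_H)
    have eig_b: "(\<Sum>j | (i, j) \<in> ladder n. a j) = ?l * b i" if "i \<in> {1..n}" for i
    proof -
      have "{j. (i, j) \<in> ladder n} = {j. (j, i) \<in> ladder n}" using ladder_sym by auto
      then show ?thesis
        using H.sum_adj_col[OF that, of y] eig[of "Inr i"] that unfolding H_pattern[OF n]
        by (simp add: y_def pverts_H)
    qed
    \<comment> \<open>the ladder maps \<open>b\<close> to \<open>?l\<close> times \<open>a\<close> and \<open>a\<close> to \<open>?l\<close> times \<open>b\<close>, so it maps \<open>a - b\<close> to \<open>- ?l\<close> times itself\<close>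
    have "a i - b i = 0" if "i \<in> {1..n}" for i
    proof (rule ladder_no_eigenvalue_below_minus_2[where d = "\<lambda>i. a i - b i", OF n l(1) _ that])
      show "(\<Sum>j | (i, j) \<in> ladder n. a j - b j) = - ?l * (a i - b i)" if "i \<in> {1..n}" for i
        unfolding sum_subtractf eig_a[OF that] eig_b[OF that] by (simp add: algebra_simps)
    qed
    then have ab: "a i = b i" if "i \<in> {1..n}" for i using that by simp
    have "(\<Sum>i=1..n. a i) + (\<Sum>i=1..n. b i) = 0"
      using x(1) unfolding G.sum_V by (simp add: a_def b_def)
    moreover have "(\<Sum>i=1..n. a i) = (\<Sum>i=1..n. b i)" by (rule sum.cong) (simp_all add: ab)
    ultimately have a0: "(\<Sum>i=1..n. a i) = 0" by simp
    have "\<exists>i\<in>{1..n}. a i \<noteq> 0"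
    proof (rule ccontr)
      assume "\<not> ?thesis"
      then have a_zero: "a i = 0" if "i \<in> {1..n}" for i using that by blast
      then have "b i = 0" if "i \<in> {1..n}" for i using that ab[OF that] by simp
      with a_zero have "S = 0" unfolding S_def G.sum_V by (simp add: a_def b_def)
      then show False using \<open>S > 0\<close> by simp
    qed
    then obtain i where nz: "i \<in> {1..n}" "a i \<noteq> 0" by blast
    have eig_aa: "(\<Sum>j | (i, j) \<in> ladder n. a j) = ?l * a i" if "i \<in> {1..n}" for i
      using eig_b[OF that] ab[OF that] by simp
    have strict: "a k < a (Suc k)" "b k < b (Suc k)" if "2 \<le> k" "k \<le> n - 2" for k
    proof -
      show *: "a k < a (Suc k)"
        by (rule ladder_eigenvector_strict_mono[where a = a, OF n l a a0 nz eig_aa that])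
      have "k \<in> {1..n}" "Suc k \<in> {1..n}" using that n by auto
      then show "b k < b (Suc k)" using * ab by simp
    qed
    have "G.pattern = ladder n"
    proof (rule G.pat.eq_ladder_if_corners_eq[OF n])
      fix k l assume kl: "2 \<le> k" "k \<le> n - 2" "2 \<le> l" "l \<le> n - 2"
      show "corner G.pattern k l = corner (ladder n) k l"
        by (rule G.pat.bilinear_le_ladder(2)[where a = a and b = b, OF n a b sums]) (use kl n strict in auto)
    qed
    then have arcs: "(p i, q j) \<in> parcs G \<longleftrightarrow> (i, j) \<in> ladder n" if "i \<in> {1..n}" "j \<in> {1..n}" for i j
      using that by (auto simp: G.pattern_def)
    show "digraph_iso (with_proj G) (with_proj (H_graph n))"
    proof (rule digraph_iso_withI[OF G0.graph H.graph])
      let ?f = "case_sum p q"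
      have disj: "v \<notin> Y" if "v \<in> X" for v using G.XY(2) that by (simp add: disjoint_iff)
      have inj: "p i = p j \<longleftrightarrow> i = j" "q i = q j \<longleftrightarrow> i = j" "p i \<noteq> q j" "q j \<noteq> p i"
        if "i \<in> {1..n}" "j \<in> {1..n}" for i j
      proof -
        show "p i = p j \<longleftrightarrow> i = j" "q i = q j \<longleftrightarrow> i = j"
          using inj_on_eq_iff[OF bij_betw_imp_inj_on[OF G.p] that]
            inj_on_eq_iff[OF bij_betw_imp_inj_on[OF G.q] that] by simp_all
        show "p i \<noteq> q j" "q j \<noteq> p i"
          using disj[OF G.p_in[OF that(1)]] G.q_in[OF that(2)] by metis+
      qed
      have "inj_on ?f (Inl ` {1..n} \<union> Inr ` {1..n})"
      proof (rule inj_onI)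
        fix v w assume "v \<in> Inl ` {1..n} \<union> Inr ` {1..n}" "w \<in> Inl ` {1..n} \<union> Inr ` {1..n}" "?f v = ?f w"
        then show "v = w"
          by (elim UnE imageE) (simp_all add: inj del: atLeastAtMost_iff)
      qed
      moreover have "?f ` (Inl ` {1..n} \<union> Inr ` {1..n}) = G0.V"
        using bij_betw_imp_surj_on[OF G.p] bij_betw_imp_surj_on[OF G.q] G.XY(1)
        by (simp add: image_Un image_image)
      ultimately show "bij_betw ?f H.V G0.V" by (simp add: bij_betw_def pverts_H)
      fix v w assume v: "v \<in> H.V" and w: "w \<in> H.V"
      have sym: "(q j, p i) \<in> parcs G \<longleftrightarrow> (p i, q j) \<in> parcs G" for i j using G0.arcs_symmetric by blast
      have no: "(p i, p j) \<notin> parcs G" "(q i, q j) \<notin> parcs G" if "i \<in> {1..n}" "j \<in> {1..n}" for i j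
        using G.edges disj G.p_in[OF that(1)] G.p_in[OF that(2)] G.q_in[OF that(1)] G.q_in[OF that(2)]
        by metis+
      show "(?f v, ?f w) \<in> parcs G \<longleftrightarrow> (v, w) \<in> parcs (H_graph n)"
        using v w unfolding pverts_H
        by (elim UnE imageE) (simp_all add: arcs sym no H_arc_iff[OF n] del: atLeastAtMost_iff)
    qed
  qed
qed

end
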